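(* Let $A=(D,\sigma,d)$, $d\in D^\times$, be a nonassociative generalized cyclic Azumaya algebra over $S_0$. (i) The subgroup of $S_0$-automorphisms of $(D,\sigma,d)$ extending $id_D$ is isomorphic to the group $$\{k\in C^\times\mid N_{C/S_0}(k)=1\}.$$ (ii) Suppose that $S_0$ contains an $m$th root of unity $\omega$, and let $\tau\in\mathrm{Aut}_{S_0}(D)$ commute with $\sigma$ and satisfy $\tau(d)=N_{C/S_0}(\omega)d=d$ (so that $H_{\tau,\omega}$ is an automorphism of $A$). If $\tau$ has finite order $s$, then the cyclic subgroup $\langle H_{\tau,\omega}\rangle$ of $\mathrm{Aut}_{S_0}(A)$ generated by $H_{\tau,\omega}$ has order at most $ms$. If $\tau$ has infinite order, then this subgroup has infinite order. In particular, $\langle H_{id,\omega}\rangle$ is a cyclic subgroup of $\mathrm{Aut}_{S_0}((D,\sigma,d))$ of order at most $m$.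
   Context: All rings are unital. $D$ is an Azumaya algebra with center $C$ (associative, finitely generated as a $C$-module, separable over $C$, center exactly $C$), of constant rank over $C$. $\sigma$ is a ring automorphism of $D$ such that $\sigma|_C$ has finite order $m\ge 2$; $\mathrm{Fix}(\sigma)=\{a\in D\mid\sigma(a)=a\}$ and $S_0=\mathrm{Fix}(\sigma)\cap C$. It is assumed that $C/S_0$ is a Galois extension of commutative rings (in the sense of Chase–Harrison–Rosenberg) with cyclic Galois group $\langle\sigma|_C\rangle$ of order $m$: $C$ is a faithfully projective $S_0$-module of constant rank $m$ and $C\otimes_{S_0}C\to\prod_{j=0}^{m-1}C$, $x\otimes y\mapsto (x\sigma^j(y))_j$, is an isomorphism. $D[t;\sigma]$ is the skew polynomial ring of left polynomials $\sum a_it^i$, $a_i\in D$, with $ta=\sigma(a)t$ for $a\in D$. For $d\in D^\times$ let $f(t)=t^m-d$. The nonassociative generalized cyclic Azumaya algebra $(D,\sigma,d)=D[t;\sigma]/D[t;\sigma]f$ is the additive group $\{g\in D[t;\sigma]\mid \deg g<m\}$ with multiplication $g\circ h$ = remainder of $gh$ under right division by $f$ (i.e. the unique $r$ with $gh=qf+r$, $\deg r<m$). It is a unital, not necessarily associative, $S_0$-algebra. $\mathrm{Aut}_{S_0}$ denotes the group of $S_0$-algebra automorphisms. $N_{C/S_0}(k)=\prod_{l=0}^{m-1}\sigma^l(k)$ for $k\in C$. For $\tau\in\mathrm{Aut}_{S_0}(D)$ and $k\in C^\times$, $$H_{\tau,k}\Big(\sum_{i=0}^{m-1}a_it^i\Big)=\tau(a_0)+\sum_{i=1}^{m-1}\tau(a_i)\Big(\prod_{l=0}^{i-1}\sigma^l(k)\Big)t^i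 .$$ An $m$th root of unity is an element $\omega$ with $\omega^m=1$. *)

theory Defs
  imports "HOL-Algebra.Algebra" "HOL-Algebra.Free_Abelian_Groups"
begin

section \<open>Modules and algebras over a ring\<close>

text \<open>
  Modules and algebras are records of type \<^typ>\<open>('r, 'a) module\<close>. The locale
  \<^locale>\<open>module\<close> requires commutative scalars; the notions below only use the operations of
  the records, so they also serve for left modules over a noncommutative ring, which are needed
  for the enveloping algebra.
\<close>

definition self_algebra :: "('a, 'b) ring_scheme \<Rightarrow> ('a, 'a) module" where
  "self_algebra R = \<lparr>carrier = carrier R, monoid.mult = monoid.mult R, one = \<one>\<^bsub>R\<^esub>,
     ring.zero = \<zero>\<^bsub>R\<^esub>, add = add R, smult = monoid.mult R\<rparr>"

text \<open>
  If \<open>R\<close> is a subring of the center of \<open>D\<close> (with the operations of \<open>D\<close>), then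
  \<^term>\<open>self_algebra D\<close> is \<open>D\<close> viewed as an \<open>R\<close>-algebra.
\<close>

definition linear_maps ::
    "('r, 'c) ring_scheme \<Rightarrow> ('r, 'a, 'd) module_scheme \<Rightarrow> ('r, 'b, 'e) module_scheme \<Rightarrow> ('a \<Rightarrow> 'b) set" where
  "linear_maps R M N = {h \<in> hom (add_monoid M) (add_monoid N).
     \<forall>r\<in>carrier R. \<forall>x\<in>carrier M. h (r \<odot>\<^bsub>M\<^esub> x) = r \<odot>\<^bsub>N\<^esub> h x}"

definition product_algebra :: "('r, 'c) ring_scheme \<Rightarrow> 'i set \<Rightarrow> ('r, 'i \<Rightarrow> 'r) module" where
  "product_algebra R I =
     \<lparr>carrier = I \<rightarrow>\<^sub>E carrier R,
      monoid.mult = \<lambda>f g. \<lambda>i\<in>I. f i \<otimes>\<^bsub>R\<^esub> g i,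
      one = \<lambda>i\<in>I. \<one>\<^bsub>R\<^esub>,
      ring.zero = \<lambda>i\<in>I. \<zero>\<^bsub>R\<^esub>,
      add = \<lambda>f g. \<lambda>i\<in>I. f i \<oplus>\<^bsub>R\<^esub> g i,
      smult = \<lambda>r f. \<lambda>i\<in>I. r \<otimes>\<^bsub>R\<^esub> f i\<rparr>"

definition free_module :: "('r, 'c) ring_scheme \<Rightarrow> 'i set \<Rightarrow> ('r, 'i \<Rightarrow> 'r) module" where
  "free_module R I = product_algebra R I
     \<lparr>carrier := {f \<in> I \<rightarrow>\<^sub>E carrier R. finite {i \<in> I. f i \<noteq> \<zero>\<^bsub>R\<^esub>}}\<rparr>"

definition finitely_generated_module :: "('r, 'c) ring_scheme \<Rightarrow> ('r, 'a, 'd) module_scheme \<Rightarrow> bool" where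
  "finitely_generated_module R M \<longleftrightarrow>
     (\<exists>B. finite B \<and> B \<subseteq> carrier M \<and>
       (\<forall>x\<in>carrier M. \<exists>c\<in>B \<rightarrow> carrier R. x = (\<Oplus>\<^bsub>M\<^esub>b\<in>B. c b \<odot>\<^bsub>M\<^esub> b)))"

text \<open>
  A module is projective if it is a direct summand of a free module. The basis of the free
  module can be taken to be a generating set of the module, so the bound on the index set
  is no restriction.
\<close>

definition projective_module :: "('r, 'c) ring_scheme \<Rightarrow> ('r, 'a, 'd) module_scheme \<Rightarrow> bool" where
  "projective_module R M \<longleftrightarrow>
     (\<exists>B \<subseteq> carrier M. \<exists>i\<in>linear_maps R M (free_module R B).
        \<exists>p\<in>linear_maps R (free_module R B) M. \<forall>x\<in>carrier M. p (i x) = x)"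

definition faithful_module :: "('r, 'c) ring_scheme \<Rightarrow> ('r, 'a, 'd) module_scheme \<Rightarrow> bool" where
  "faithful_module R M \<longleftrightarrow>
     (\<forall>r\<in>carrier R. (\<forall>x\<in>carrier M. r \<odot>\<^bsub>M\<^esub> x = \<zero>\<^bsub>M\<^esub>) \<longrightarrow> r = \<zero>\<^bsub>R\<^esub>)"

definition faithfully_projective :: "('r, 'c) ring_scheme \<Rightarrow> ('r, 'a, 'd) module_scheme \<Rightarrow> bool" where
  "faithfully_projective R M \<longleftrightarrow>
     finitely_generated_module R M \<and> projective_module R M \<and> faithful_module R M"


section \<open>Localization at a prime and constant rank\<close>

definition frac_rel ::
    "('r, 'c) ring_scheme \<Rightarrow> 'r set \<Rightarrow> ('r, 'a, 'd) module_scheme \<Rightarrow> (('a \<times> 'r) \<times> ('a \<times> 'r)) set" where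
  "frac_rel R P M = {((x, s), (y, t)) | x s y t.
     x \<in> carrier M \<and> y \<in> carrier M \<and> s \<in> carrier R - P \<and> t \<in> carrier R - P \<and>
     (\<exists>u\<in>carrier R - P. u \<odot>\<^bsub>M\<^esub> (t \<odot>\<^bsub>M\<^esub> x) = u \<odot>\<^bsub>M\<^esub> (s \<odot>\<^bsub>M\<^esub> y))}"

definition fraction ::
    "('r, 'c) ring_scheme \<Rightarrow> 'r set \<Rightarrow> ('r, 'a, 'd) module_scheme \<Rightarrow> 'a \<Rightarrow> 'r \<Rightarrow> ('a \<times> 'r) set" where
  "fraction R P M x s = frac_rel R P M `` {(x, s)}"

text \<open>
  The operations act on representatives; as usual for quotients by congruences, the union
  over all representatives of classes \<open>U\<close>, \<open>V\<close> joins equal classes.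
\<close>

definition localization ::
    "('r, 'c) ring_scheme \<Rightarrow> 'r set \<Rightarrow> ('r, 'a, 'd) module_scheme
      \<Rightarrow> (('r \<times> 'r) set, ('a \<times> 'r) set) module" where
  "localization R P M =
     \<lparr>carrier = (carrier M \<times> (carrier R - P)) // frac_rel R P M,
      monoid.mult = \<lambda>U V. \<Union>{fraction R P M (x \<otimes>\<^bsub>M\<^esub> y) (s \<otimes>\<^bsub>R\<^esub> t) | x s y t. (x, s) \<in> U \<and> (y, t) \<in> V},
      one = fraction R P M \<one>\<^bsub>M\<^esub> \<one>\<^bsub>R\<^esub>,
      ring.zero = fraction R P M \<zero>\<^bsub>M\<^esub> \<one>\<^bsub>R\<^esub>,
      add = \<lambda>U V. \<Union>{fraction R P M (t \<odot>\<^bsub>M\<^esub> x \<oplus>\<^bsub>M\<^esub> s \<odot>\<^bsub>M\<^esub> y) (s \<otimes>\<^bsub>R\<^esub> t) | x s y t.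
        (x, s) \<in> U \<and> (y, t) \<in> V},
      smult = \<lambda>U V. \<Union>{fraction R P M (r \<odot>\<^bsub>M\<^esub> y) (s \<otimes>\<^bsub>R\<^esub> t) | r s y t. (r, s) \<in> U \<and> (y, t) \<in> V}\<rparr>"

definition has_constant_rank :: "('r, 'c) ring_scheme \<Rightarrow> ('r, 'a, 'd) module_scheme \<Rightarrow> nat \<Rightarrow> bool" where
  "has_constant_rank R M n \<longleftrightarrow>
     (\<forall>P. primeideal P R \<longrightarrow>
       (\<exists>h\<in>linear_maps (localization R P (self_algebra R)) (localization R P M)
              (free_module (localization R P (self_algebra R)) {..<n}).
          bij_betw h (carrier (localization R P M))
            (carrier (free_module (localization R P (self_algebra R)) {..<n}))))"


section \<open>Tensor products\<close>

definition tensor_relations ::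
    "('r, 'c) ring_scheme \<Rightarrow> ('r, 'a, 'd) module_scheme \<Rightarrow> ('r, 'b, 'e) module_scheme
      \<Rightarrow> ('a \<times> 'b \<Rightarrow>\<^sub>0 int) set" where
  "tensor_relations R M N =
     {frag_of (x \<oplus>\<^bsub>M\<^esub> x', y) - frag_of (x, y) - frag_of (x', y) | x x' y.
        x \<in> carrier M \<and> x' \<in> carrier M \<and> y \<in> carrier N} \<union>
     {frag_of (x, y \<oplus>\<^bsub>N\<^esub> y') - frag_of (x, y) - frag_of (x, y') | x y y'.
        x \<in> carrier M \<and> y \<in> carrier N \<and> y' \<in> carrier N} \<union>
     {frag_of (r \<odot>\<^bsub>M\<^esub> x, y) - frag_of (x, r \<odot>\<^bsub>N\<^esub> y) | r x y.
        r \<in> carrier R \<and> x \<in> carrier M \<and> y \<in> carrier N}"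

definition tensor_kernel ::
    "('r, 'c) ring_scheme \<Rightarrow> ('r, 'a, 'd) module_scheme \<Rightarrow> ('r, 'b, 'e) module_scheme
      \<Rightarrow> ('a \<times> 'b \<Rightarrow>\<^sub>0 int) set" where
  "tensor_kernel R M N =
     generate (free_Abelian_group (carrier M \<times> carrier N)) (tensor_relations R M N)"

definition tensor_group ::
    "('r, 'c) ring_scheme \<Rightarrow> ('r, 'a, 'd) module_scheme \<Rightarrow> ('r, 'b, 'e) module_scheme
      \<Rightarrow> ('a \<times> 'b \<Rightarrow>\<^sub>0 int) set monoid" where
  "tensor_group R M N = free_Abelian_group (carrier M \<times> carrier N) Mod tensor_kernel R M N"

definition pure_tensor ::
    "('r, 'c) ring_scheme \<Rightarrow> ('r, 'a, 'd) module_scheme \<Rightarrow> ('r, 'b, 'e) module_scheme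
      \<Rightarrow> 'a \<Rightarrow> 'b \<Rightarrow> ('a \<times> 'b \<Rightarrow>\<^sub>0 int) set" where
  "pure_tensor R M N x y =
     tensor_kernel R M N #>\<^bsub>free_Abelian_group (carrier M \<times> carrier N)\<^esub> frag_of (x, y)"

text \<open>
  The homomorphism from a tensor product to the commutative group \<open>G\<close> (written
  multiplicatively) that sends the pure tensor of \<open>x\<close> and \<open>y\<close> to \<open>\<phi> x y\<close>. If \<open>\<phi>\<close> is
  biadditive and balanced, the value does not depend on the representative of the coset,
  and the image below is a singleton.
\<close>

definition tensor_lift ::
    "('g, 'c) monoid_scheme \<Rightarrow> ('a \<Rightarrow> 'b \<Rightarrow> 'g) \<Rightarrow> ('a \<times> 'b \<Rightarrow>\<^sub>0 int) set \<Rightarrow> 'g" where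
  "tensor_lift G \<phi> U = the_elem
     ((\<lambda>z. finprod G (\<lambda>(x, y). \<phi> x y [^]\<^bsub>G\<^esub> Poly_Mapping.lookup z (x, y)) (Poly_Mapping.keys z)) ` U)"

definition tensor_algebra ::
    "('r, 'c) ring_scheme \<Rightarrow> ('r, 'a, 'd) module_scheme \<Rightarrow> ('r, 'b, 'e) module_scheme
      \<Rightarrow> ('a \<times> 'b \<Rightarrow>\<^sub>0 int) set ring" where
  "tensor_algebra R A B =
     \<lparr>carrier = carrier (tensor_group R A B),
      monoid.mult = \<lambda>U V. tensor_lift (tensor_group R A B)
        (\<lambda>a b. tensor_lift (tensor_group R A B)
          (\<lambda>a' b'. pure_tensor R A B (a \<otimes>\<^bsub>A\<^esub> a') (b \<otimes>\<^bsub>B\<^esub> b')) V) U,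
      one = pure_tensor R A B \<one>\<^bsub>A\<^esub> \<one>\<^bsub>B\<^esub>,
      ring.zero = \<one>\<^bsub>tensor_group R A B\<^esub>,
      add = monoid.mult (tensor_group R A B)\<rparr>"


section \<open>Separable and Azumaya algebras\<close>

definition opposite_algebra :: "('r, 'a) module \<Rightarrow> ('r, 'a) module" where
  "opposite_algebra A = A\<lparr>monoid.mult := \<lambda>x y. y \<otimes>\<^bsub>A\<^esub> x\<rparr>"

definition enveloping_algebra ::
    "('r, 'c) ring_scheme \<Rightarrow> ('r, 'a) module \<Rightarrow> ('a \<times> 'a \<Rightarrow>\<^sub>0 int) set ring" where
  "enveloping_algebra R A = tensor_algebra R A (opposite_algebra A)"

text \<open>\<open>A\<close> as a left module over its enveloping algebra: \<open>(a \<otimes> b) x = a x b\<close>.\<close>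

definition enveloping_module ::
    "('r, 'a) module \<Rightarrow> (('a \<times> 'a \<Rightarrow>\<^sub>0 int) set, 'a) module" where
  "enveloping_module A =
     \<lparr>carrier = carrier A, monoid.mult = monoid.mult A, one = \<one>\<^bsub>A\<^esub>,
      ring.zero = \<zero>\<^bsub>A\<^esub>, add = add A,
      smult = \<lambda>U x. tensor_lift (add_monoid A) (\<lambda>a b. a \<otimes>\<^bsub>A\<^esub> x \<otimes>\<^bsub>A\<^esub> b) U\<rparr>"

definition separable_algebra :: "('r, 'c) ring_scheme \<Rightarrow> ('r, 'a) module \<Rightarrow> bool" where
  "separable_algebra R A \<longleftrightarrow> projective_module (enveloping_algebra R A) (enveloping_module A)"

definition center :: "('a, 'b) ring_scheme \<Rightarrow> 'a set" where
  "center D = {c \<in> carrier D. \<forall>a\<in>carrier D. c \<otimes>\<^bsub>D\<^esub> a = a \<otimes>\<^bsub>D\<^esub> c}"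

definition center_ring :: "('a, 'b) ring_scheme \<Rightarrow> ('a, 'b) ring_scheme" where
  "center_ring D = D\<lparr>carrier := center D\<rparr>"

definition azumaya :: "('a, 'b) ring_scheme \<Rightarrow> bool" where
  "azumaya D \<longleftrightarrow> ring D \<and>
     finitely_generated_module (center_ring D) (self_algebra D) \<and>
     separable_algebra (center_ring D) (self_algebra D)"


section \<open>Automorphism groups and cyclic Galois extensions\<close>

definition algebra_autos :: "('r, 'c) ring_scheme \<Rightarrow> ('r, 'a, 'd) module_scheme \<Rightarrow> ('a \<Rightarrow> 'a) set" where
  "algebra_autos R A = ring_iso A A \<inter> linear_maps R A A \<inter> extensional (carrier A)"

definition algebra_auto_group ::
    "('r, 'c) ring_scheme \<Rightarrow> ('r, 'a, 'd) module_scheme \<Rightarrow> ('a \<Rightarrow> 'a) monoid" where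
  "algebra_auto_group R A = BijGroup (carrier A)\<lparr>carrier := algebra_autos R A\<rparr>"

definition fixed_center_ring :: "('a, 'b) ring_scheme \<Rightarrow> ('a \<Rightarrow> 'a) \<Rightarrow> ('a, 'b) ring_scheme" where
  "fixed_center_ring D \<sigma> = D\<lparr>carrier := {a \<in> carrier D. \<sigma> a = a} \<inter> center D\<rparr>"

text \<open>
  \<open>S\<close> is a subring of the commutative ring \<open>C\<close>, and the Galois group is generated by \<open>\<sigma>\<close>
  restricted to \<open>C\<close>.
\<close>

definition cyclic_galois_extension ::
    "('a, 'b) ring_scheme \<Rightarrow> ('a, 'c) ring_scheme \<Rightarrow> ('a \<Rightarrow> 'a) \<Rightarrow> nat \<Rightarrow> bool" where
  "cyclic_galois_extension S C \<sigma> m \<longleftrightarrow>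
     group.ord (algebra_auto_group S (self_algebra C)) (restrict \<sigma> (carrier C)) = m \<and>
     faithfully_projective S (self_algebra C) \<and>
     has_constant_rank S (self_algebra C) m \<and>
     tensor_lift (add_monoid (product_algebra C {..<m})) (\<lambda>x y. \<lambda>j\<in>{..<m}. x \<otimes>\<^bsub>C\<^esub> (\<sigma> ^^ j) y)
       \<in> ring_iso (tensor_algebra S (self_algebra C) (self_algebra C)) (product_algebra C {..<m})"


section \<open>Skew polynomials and nonassociative generalized cyclic algebras\<close>

text \<open>Polynomials are represented by their left coefficients, and \<open>t a = \<sigma>(a) t\<close>.\<close>

definition skew_monom :: "('a, 'b) ring_scheme \<Rightarrow> 'a \<Rightarrow> nat \<Rightarrow> nat \<Rightarrow> 'a" where
  "skew_monom D a n = (\<lambda>i. if i = n then a else \<zero>\<^bsub>D\<^esub>)"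

definition skew_poly_ring :: "('a, 'b) ring_scheme \<Rightarrow> ('a \<Rightarrow> 'a) \<Rightarrow> (nat \<Rightarrow> 'a) ring" where
  "skew_poly_ring D \<sigma> =
     \<lparr>carrier = up D,
      monoid.mult = \<lambda>p q n. \<Oplus>\<^bsub>D\<^esub>i\<in>{..n}. p i \<otimes>\<^bsub>D\<^esub> (\<sigma> ^^ i) (q (n - i)),
      one = skew_monom D \<one>\<^bsub>D\<^esub> 0,
      ring.zero = (\<lambda>i. \<zero>\<^bsub>D\<^esub>),
      add = \<lambda>p q i. p i \<oplus>\<^bsub>D\<^esub> q i\<rparr>"

definition polys_below :: "('a, 'b) ring_scheme \<Rightarrow> nat \<Rightarrow> (nat \<Rightarrow> 'a) set" where
  "polys_below D m = {g \<in> up D. \<forall>i\<ge>m. g i = \<zero>\<^bsub>D\<^esub>}"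

definition binomial_poly :: "('a, 'b) ring_scheme \<Rightarrow> ('a \<Rightarrow> 'a) \<Rightarrow> nat \<Rightarrow> 'a \<Rightarrow> nat \<Rightarrow> 'a" where
  "binomial_poly D \<sigma> m d =
     skew_monom D \<one>\<^bsub>D\<^esub> m \<ominus>\<^bsub>skew_poly_ring D \<sigma>\<^esub> skew_monom D d 0"

definition right_remainder ::
    "('a, 'b) ring_scheme \<Rightarrow> ('a \<Rightarrow> 'a) \<Rightarrow> nat \<Rightarrow> 'a \<Rightarrow> (nat \<Rightarrow> 'a) \<Rightarrow> nat \<Rightarrow> 'a" where
  "right_remainder D \<sigma> m d p = (THE r. r \<in> polys_below D m \<and>
     (\<exists>q\<in>carrier (skew_poly_ring D \<sigma>).
        p = q \<otimes>\<^bsub>skew_poly_ring D \<sigma>\<^esub> binomial_poly D \<sigma> m d \<oplus>\<^bsub>skew_poly_ring D \<sigma>\<^esub> r))"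

definition gen_cyclic_algebra ::
    "('a, 'b) ring_scheme \<Rightarrow> ('a \<Rightarrow> 'a) \<Rightarrow> nat \<Rightarrow> 'a \<Rightarrow> ('a, nat \<Rightarrow> 'a) module" where
  "gen_cyclic_algebra D \<sigma> m d =
     \<lparr>carrier = polys_below D m,
      monoid.mult = \<lambda>g h. right_remainder D \<sigma> m d (g \<otimes>\<^bsub>skew_poly_ring D \<sigma>\<^esub> h),
      one = \<one>\<^bsub>skew_poly_ring D \<sigma>\<^esub>,
      ring.zero = \<zero>\<^bsub>skew_poly_ring D \<sigma>\<^esub>,
      add = add (skew_poly_ring D \<sigma>),
      smult = \<lambda>s g i. s \<otimes>\<^bsub>D\<^esub> g i\<rparr>"

text \<open>\<open>\<Prod>l<n. \<sigma>^l(k)\<close> for central \<open>k\<close>; for \<open>n = m\<close> this is the norm of the Galois extension.\<close>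

definition orbit_prod :: "('a, 'b) ring_scheme \<Rightarrow> ('a \<Rightarrow> 'a) \<Rightarrow> nat \<Rightarrow> 'a \<Rightarrow> 'a" where
  "orbit_prod D \<sigma> n k = (\<Otimes>\<^bsub>center_ring D\<^esub>l\<in>{..<n}. (\<sigma> ^^ l) k)"

definition H_map ::
    "('a, 'b) ring_scheme \<Rightarrow> ('a \<Rightarrow> 'a) \<Rightarrow> nat \<Rightarrow> ('a \<Rightarrow> 'a) \<Rightarrow> 'a \<Rightarrow> (nat \<Rightarrow> 'a) \<Rightarrow> nat \<Rightarrow> 'a" where
  "H_map D \<sigma> m \<tau> k =
     (\<lambda>a\<in>polys_below D m. \<lambda>i. \<tau> (a i) \<otimes>\<^bsub>D\<^esub> orbit_prod D \<sigma> i k)"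

definition autos_extending_id ::
    "('a, 'b) ring_scheme \<Rightarrow> ('a \<Rightarrow> 'a) \<Rightarrow> nat \<Rightarrow> 'a \<Rightarrow> ((nat \<Rightarrow> 'a) \<Rightarrow> nat \<Rightarrow> 'a) set" where
  "autos_extending_id D \<sigma> m d =
     {H \<in> algebra_autos (fixed_center_ring D \<sigma>) (gen_cyclic_algebra D \<sigma> m d).
        \<forall>a\<in>carrier D. H (skew_monom D a 0) = skew_monom D a 0}"

definition norm_one_units :: "('a, 'b) ring_scheme \<Rightarrow> ('a \<Rightarrow> 'a) \<Rightarrow> nat \<Rightarrow> 'a set" where
  "norm_one_units D \<sigma> m = {k \<in> Units (center_ring D). orbit_prod D \<sigma> m k = \<one>\<^bsub>D\<^esub>}"

end

theory Submission
  imports Defs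
begin

text \<open>
  Let \<open>F\<close> be an automorphism of \<open>A\<close> fixing \<open>D\<close>, and \<open>F(t) = \<Sum> k\<^sub>i t\<^sup>i\<close>. Applying \<open>F\<close> to
  \<open>t a = \<sigma>(a) t\<close> gives \<open>k\<^sub>i \<sigma>\<^sup>i(a) = \<sigma>(a) k\<^sub>i\<close> for all \<open>a\<close>. For central \<open>a\<close> the Galois condition
  forces \<open>k\<^sub>i = 0\<close> when \<open>i \<noteq> 1\<close>, and then \<open>k = k\<^sub>1\<close> commutes with \<open>\<sigma>(D) = D\<close>. So \<open>F\<close> is \<open>H(id, k)\<close>;
  surjectivity makes \<open>k\<close> a unit, and \<open>t t\<^bsup>m-1\<^esup> = d\<close> gives \<open>N(k) = 1\<close>.
  For \<open>\<omega>\<close> in \<open>S\<^sub>0\<close> the powers are \<open>H(\<tau>, \<omega>)\<^sup>n = H(\<tau>\<^sup>n, \<omega>\<^sup>n)\<close>, which is the identity for \<open>n = m s\<close> if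
  \<open>\<tau>\<^sup>s = id\<close>, and restricts to \<open>\<tau>\<^sup>n\<close> on \<open>D\<close>.
\<close>

section \<open>Maps out of a tensor product\<close>

text \<open>This is the universal property of the free abelian group: the formula extends
  \<open>f\<close> to a homomorphism. All products are compared over the union of the two supports,
  since cancellation may shrink the support of \<open>x + y\<close>.\<close>

lemma (in comm_group) finprod_frag_hom:
  assumes f: "f \<in> S \<rightarrow> carrier G"
  shows "(\<lambda>z. finprod G (\<lambda>s. f s [^] Poly_Mapping.lookup z s) (Poly_Mapping.keys z))
    \<in> hom (free_Abelian_group S) G" (is "?\<Phi> \<in> _")
proof (rule homI)
  fix x assume "x \<in> carrier (free_Abelian_group S)"
  then show "?\<Phi> x \<in> carrier G"
    using f by (auto intro!: finprod_closed)
next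
  fix x y assume xy: "x \<in> carrier (free_Abelian_group S)" "y \<in> carrier (free_Abelian_group S)"
  let ?K = "Poly_Mapping.keys x \<union> Poly_Mapping.keys y"
  have K: "\<And>s. s \<in> ?K \<Longrightarrow> f s \<in> carrier G"
    using f xy by auto
  \<comment> \<open>Additional indices have coefficient 0 and contribute the factor
    \<open>f s [^] 0 = \<one>\<close>.\<close>
  have extend: "?\<Phi> z = finprod G (\<lambda>s. f s [^] Poly_Mapping.lookup z s) ?K"
    if "Poly_Mapping.keys z \<subseteq> ?K" for z
    by (rule finprod_mono_neutral_cong_left) (use that K in \<open>auto simp: in_keys_iff\<close>)
  have "?\<Phi> (x + y)
      = finprod G (\<lambda>s. f s [^] Poly_Mapping.lookup x s \<otimes> f s [^] Poly_Mapping.lookup y s) ?K"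
    unfolding extend[OF keys_add]
    by (rule finprod_cong') (use K in \<open>auto simp: lookup_add int_pow_mult\<close>)
  also have "\<dots> = ?\<Phi> x \<otimes> ?\<Phi> y"
    using K by (subst finprod_multf) (auto simp: extend)
  finally show "?\<Phi> (x \<otimes>\<^bsub>free_Abelian_group S\<^esub> y) = ?\<Phi> x \<otimes> ?\<Phi> y"
    by simp
qed

text \<open>Lets a property that defines a subgroup pass from pure tensors to arbitrary tensors. For
  infinite \<open>A\<close> the product defaults to \<open>\<one>\<close>, which lies in
  \<open>H\<close> as well.\<close>

lemma (in comm_group) finprod_subgroup_closed:
  assumes "subgroup H G" "f \<in> A \<rightarrow> H"
  shows "finprod G f A \<in> H"
  using assms(2)
proof (induction A rule: infinite_finite_induct)
  case (insert a A)
  then show ?case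
    using assms(1) by (subst finprod_insert) (auto simp: subgroup.m_closed dest: subgroup.mem_carrier)
qed (use subgroup.one_closed[OF assms(1)] in auto)

text \<open>A biadditive balanced \<open>\<phi>\<close> sends every tensor relation to
  \<open>\<one>\<close>, so its extension to formal sums is constant on cosets of the kernel. The
  image taken in \<open>tensor_lift\<close> is therefore a singleton, and any representative
  \<open>z\<close> computes it.\<close>

lemma (in comm_group) tensor_lift_coset:
  assumes z: "z \<in> carrier (free_Abelian_group (carrier M \<times> carrier N))"
    and closed: "\<And>x y. x \<in> carrier M \<Longrightarrow> y \<in> carrier N \<Longrightarrow> \<phi> x y \<in> carrier G"
    and M: "\<And>x x'. x \<in> carrier M \<Longrightarrow> x' \<in> carrier M \<Longrightarrow> x \<oplus>\<^bsub>M\<^esub> x' \<in> carrier M"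
      "\<And>r x. r \<in> carrier R \<Longrightarrow> x \<in> carrier M \<Longrightarrow> r \<odot>\<^bsub>M\<^esub> x \<in> carrier M"
    and N: "\<And>y y'. y \<in> carrier N \<Longrightarrow> y' \<in> carrier N \<Longrightarrow> y \<oplus>\<^bsub>N\<^esub> y' \<in> carrier N"
      "\<And>r y. r \<in> carrier R \<Longrightarrow> y \<in> carrier N \<Longrightarrow> r \<odot>\<^bsub>N\<^esub> y \<in> carrier N"
    and addl: "\<And>x x' y. x \<in> carrier M \<Longrightarrow> x' \<in> carrier M \<Longrightarrow> y \<in> carrier N
      \<Longrightarrow> \<phi> (x \<oplus>\<^bsub>M\<^esub> x') y = \<phi> x y \<otimes> \<phi> x' y"
    and addr: "\<And>x y y'. x \<in> carrier M \<Longrightarrow> y \<in> carrier N \<Longrightarrow> y' \<in> carrier N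
      \<Longrightarrow> \<phi> x (y \<oplus>\<^bsub>N\<^esub> y') = \<phi> x y \<otimes> \<phi> x y'"
    and bal: "\<And>r x y. r \<in> carrier R \<Longrightarrow> x \<in> carrier M \<Longrightarrow> y \<in> carrier N
      \<Longrightarrow> \<phi> (r \<odot>\<^bsub>M\<^esub> x) y = \<phi> x (r \<odot>\<^bsub>N\<^esub> y)"
  shows "tensor_lift G \<phi> (tensor_kernel R M N #>\<^bsub>free_Abelian_group (carrier M \<times> carrier N)\<^esub> z)
    = finprod G (\<lambda>(x, y). \<phi> x y [^] Poly_Mapping.lookup z (x, y)) (Poly_Mapping.keys z)"
proof -
  let ?S = "carrier M \<times> carrier N"
  let ?F = "free_Abelian_group ?S"
  define \<Phi> :: "(_ \<Rightarrow>\<^sub>0 int) \<Rightarrow> _" where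
    "\<Phi> = (\<lambda>z. finprod G (\<lambda>(x, y). \<phi> x y [^] Poly_Mapping.lookup z (x, y)) (Poly_Mapping.keys z))"
  have "\<Phi> \<in> hom ?F G"
    using finprod_frag_hom[of "case_prod \<phi>" ?S] closed
    by (auto simp: \<Phi>_def case_prod_unfold Pi_def)
  then interpret \<Phi>: group_hom ?F G \<Phi>
    by (simp add: group_hom_def group_hom_axioms_def is_group)
  have frag: "\<Phi> (frag_of (x, y)) = \<phi> x y" if "x \<in> carrier M" "y \<in> carrier N" for x y
    using that closed by (simp add: \<Phi>_def finprod_insert)
  have minus: "\<Phi> (a - b) = \<Phi> a \<otimes> inv \<Phi> b" if "a \<in> carrier ?F" "b \<in> carrier ?F" for a b
    using \<Phi>.hom_mult[of a "inv\<^bsub>?F\<^esub> b"] that \<Phi>.hom_inv[of b] \<Phi>.G.inv_closed[of b] by simp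
  have minus_mem: "a - b \<in> carrier ?F" if "a \<in> carrier ?F" "b \<in> carrier ?F" for a b
    using \<Phi>.G.m_closed[of a "inv\<^bsub>?F\<^esub> b"] that \<Phi>.G.inv_closed[of b] by simp
  \<comment> \<open>The shape that the two additivity relations take after \<open>addl\<close> or
    \<open>addr\<close> has been applied.\<close>
  have cancel: "a \<otimes> b \<otimes> inv a \<otimes> inv b = \<one>" if "a \<in> carrier G" "b \<in> carrier G" for a b
    using that by (metis inv_closed m_assoc m_closed m_comm r_inv inv_mult)
  have "tensor_relations R M N \<subseteq> kernel ?F G \<Phi>"
    unfolding tensor_relations_def kernel_def
    using minus_mem by (auto simp del: carrier_free_Abelian_group_iff simp: minus frag closed M N addl addr bal cancel)
  then have ker: "tensor_kernel R M N \<subseteq> kernel ?F G \<Phi>"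
    unfolding tensor_kernel_def
    by (intro \<Phi>.G.generate_subgroup_incl \<Phi>.subgroup_kernel)
  \<comment> \<open>Hence \<open>z\<close> belongs to its own coset, and the image of the coset is
    not empty.\<close>
  have zero: "0 \<in> tensor_kernel R M N"
    unfolding tensor_kernel_def using generate.one[of ?F] by simp
  have "\<Phi> ` (tensor_kernel R M N #>\<^bsub>?F\<^esub> z) = {\<Phi> z}"
  proof -
    have "\<Phi> (u \<otimes>\<^bsub>?F\<^esub> z) = \<Phi> z" if "u \<in> tensor_kernel R M N" for u
      using that ker z \<Phi>.hom_closed[OF z] by (subst \<Phi>.hom_mult) (auto simp: kernel_def)
    moreover have "\<Phi> z \<in> \<Phi> ` (tensor_kernel R M N #>\<^bsub>?F\<^esub> z)"
      using zero by (force simp: r_coset_def)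
    ultimately show ?thesis
      by (auto simp: r_coset_def)
  qed
  then show ?thesis
    by (simp add: tensor_lift_def \<Phi>_def)
qed

section \<open>The center and the orbit products\<close>

lemma self_algebra_simps [simp]:
  "carrier (self_algebra R) = carrier R"
  "monoid.mult (self_algebra R) = monoid.mult R"
  "one (self_algebra R) = one R"
  "ring.zero (self_algebra R) = ring.zero R"
  "add (self_algebra R) = add R"
  "smult (self_algebra R) = monoid.mult R"
  by (simp_all add: self_algebra_def)

lemma center_ring_simps [simp]:
  "carrier (center_ring D) = center D"
  "monoid.mult (center_ring D) = monoid.mult D"
  "one (center_ring D) = one D"
  "ring.zero (center_ring D) = ring.zero D"
  "add (center_ring D) = add D"
  by (simp_all add: center_ring_def)

lemma fixed_center_ring_carrier [simp]:
  "carrier (fixed_center_ring D \<sigma>) = {a \<in> carrier D. \<sigma> a = a} \<inter> center D"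
  by (simp add: fixed_center_ring_def)

lemma center_closed: "c \<in> center D \<Longrightarrow> c \<in> carrier D"
  by (simp add: center_def)

lemma centerI:
  "c \<in> carrier D \<Longrightarrow> (\<And>a. a \<in> carrier D \<Longrightarrow> c \<otimes>\<^bsub>D\<^esub> a = a \<otimes>\<^bsub>D\<^esub> c) \<Longrightarrow> c \<in> center D"
  by (simp add: center_def)

lemma center_comm: "c \<in> center D \<Longrightarrow> a \<in> carrier D \<Longrightarrow> c \<otimes>\<^bsub>D\<^esub> a = a \<otimes>\<^bsub>D\<^esub> c"
  by (simp add: center_def)

lemma (in ring) center_m_closed: "a \<in> center R \<Longrightarrow> b \<in> center R \<Longrightarrow> a \<otimes> b \<in> center R"
proof -
  assume ab: "a \<in> center R" "b \<in> center R"
  have "(a \<otimes> b) \<otimes> x = x \<otimes> (a \<otimes> b)" if x: "x \<in> carrier R" for x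
  proof -
    have "(a \<otimes> b) \<otimes> x = a \<otimes> (x \<otimes> b)"
      using ab x center_comm[OF ab(2) x] by (simp add: m_assoc center_closed)
    also have "\<dots> = x \<otimes> (a \<otimes> b)"
      using ab x center_comm[OF ab(1) x] by (simp add: center_closed flip: m_assoc)
    finally show ?thesis .
  qed
  then show ?thesis
    using ab by (intro centerI) (simp_all add: center_closed)
qed

lemma (in ring) center_a_closed:
  assumes "a \<in> center R" "b \<in> center R"
  shows "a \<oplus> b \<in> center R"
proof (rule centerI)
  fix x assume x: "x \<in> carrier R"
  show "(a \<oplus> b) \<otimes> x = x \<otimes> (a \<oplus> b)"
    using assms x center_comm[OF assms(1) x] center_comm[OF assms(2) x]
    by (simp add: center_closed l_distr r_distr)
qed (use assms in \<open>simp add: center_closed\<close>)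

lemma (in ring) center_one: "\<one> \<in> center R"
  by (simp add: center_def)

lemma (in ring) center_zero: "\<zero> \<in> center R"
  by (simp add: center_def)

text \<open>\<open>orbit_prod\<close> is a product taken in \<open>center_ring\<close>; its rules
  become available once this ring is known to be commutative.\<close>

lemma (in ring) cring_center_ring: "cring (center_ring R)"
proof -
  have "abelian_group (center_ring R)"
  proof (rule abelian_groupI)
    fix x assume x: "x \<in> carrier (center_ring R)"
    then have "\<ominus> x \<in> center R"
      using center_comm[of x R] by (intro centerI) (simp_all add: center_closed l_minus r_minus)
    with x show "\<exists>y\<in>carrier (center_ring R). y \<oplus>\<^bsub>center_ring R\<^esub> x = \<zero>\<^bsub>center_ring R\<^esub>"
      by (intro bexI[of _ "\<ominus> x"]) (simp_all add: center_closed l_neg)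
  qed (simp_all add: center_closed center_a_closed center_zero a_ac)
  moreover have "comm_monoid (center_ring R)"
  proof (rule comm_monoidI)
    fix x y assume "x \<in> carrier (center_ring R)" "y \<in> carrier (center_ring R)"
    then show "x \<otimes>\<^bsub>center_ring R\<^esub> y = y \<otimes>\<^bsub>center_ring R\<^esub> x"
      using center_comm[of x R y] by (simp add: center_closed)
  qed (simp_all add: center_m_closed center_one m_assoc center_closed)
  ultimately show ?thesis
    by (intro cringI) (auto simp: center_closed l_distr)
qed

text \<open>The inverse of a central unit is again central: insert \<open>k \<otimes> inv k\<close>
  to the right of \<open>a\<close>, move \<open>k\<close> to the left of \<open>a\<close>, and
  cancel it against \<open>inv k\<close>.\<close>

lemma (in ring) Units_center_ring: "Units (center_ring R) = center R \<inter> Units R"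
proof -
  have "inv k \<in> center R" if "k \<in> center R" "k \<in> Units R" for k
  proof -
    have "inv k \<otimes> a = a \<otimes> inv k" if a: "a \<in> carrier R" for a
    proof -
      have "inv k \<otimes> a = inv k \<otimes> (a \<otimes> (k \<otimes> inv k))"
        using \<open>k \<in> Units R\<close> a by simp
      also have "\<dots> = inv k \<otimes> (a \<otimes> k) \<otimes> inv k"
        using \<open>k \<in> Units R\<close> a by (simp add: m_assoc Units_closed)
      also have "\<dots> = inv k \<otimes> (k \<otimes> a) \<otimes> inv k"
        using center_comm[OF \<open>k \<in> center R\<close> a] by simp
      also have "\<dots> = a \<otimes> inv k"
        using \<open>k \<in> Units R\<close> a by (simp add: Units_closed flip: m_assoc)
      finally show ?thesis .
    qed
    then show ?thesis
      using that by (intro centerI) simp_all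
  qed
  then have "k \<in> Units (center_ring R)" if "k \<in> center R" "k \<in> Units R" for k
    using that by (auto simp: Units_def[of "center_ring R"] intro!: bexI[of _ "inv k"])
  moreover have "k \<in> center R \<inter> Units R" if "k \<in> Units (center_ring R)" for k
    using that by (auto simp: Units_def center_closed)
  ultimately show ?thesis
    by blast
qed

section \<open>Iterates of \<open>\<sigma>\<close>, orbit products and the Galois condition\<close>

locale skew_cyclic = ring D for D (structure) +
  fixes \<sigma> :: "'a \<Rightarrow> 'a" and m :: nat and d :: 'a
  assumes sigma: "\<sigma> \<in> ring_iso D D"
    and m_ge_2: "m \<ge> 2"
    and d_unit: "d \<in> Units D"
begin

lemma d_closed [simp]: "d \<in> carrier D"
  using d_unit by (rule Units_closed)

lemma sigma_pow_iso: "\<sigma> ^^ n \<in> ring_iso D D"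
proof (induction n)
  case 0
  then show ?case by (auto simp: ring_iso_def ring_hom_def bij_betw_def)
next
  case (Suc n)
  then show ?case
    using ring_iso_set_trans[OF Suc sigma] by (simp only: funpow.simps)
qed

lemmas sigma_pow_closed [simp] = ring_iso_memE(1)[OF sigma_pow_iso]
  and sigma_pow_mult = ring_iso_memE(2)[OF sigma_pow_iso]
  and sigma_pow_add = ring_iso_memE(3)[OF sigma_pow_iso]
  and sigma_pow_one [simp] = ring_iso_memE(4)[OF sigma_pow_iso]
  and sigma_pow_bij = ring_iso_memE(5)[OF sigma_pow_iso]
  and sigma_closed [simp] = ring_iso_memE(1)[OF sigma]
  and sigma_one [simp] = ring_iso_memE(4)[OF sigma]

lemma sigma_pow_add_pow: "(\<sigma> ^^ i) ((\<sigma> ^^ j) a) = (\<sigma> ^^ (i + j)) a"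
  by (simp add: funpow_add)

lemma sigma_pow_zero [simp]: "(\<sigma> ^^ n) \<zero> = \<zero>"
  using ring_hom_zero[OF _ ring_axioms ring_axioms] sigma_pow_iso by (auto simp: ring_iso_def)

text \<open>Since \<open>\<sigma> ^^ n\<close> maps onto \<open>D\<close>, it suffices to test
  commutation against elements of the form \<open>(\<sigma> ^^ n) a\<close>.\<close>

lemma sigma_pow_center [simp]: "k \<in> center D \<Longrightarrow> (\<sigma> ^^ n) k \<in> center D"
proof -
  assume k: "k \<in> center D"
  have "(\<sigma> ^^ n) k \<otimes> b = b \<otimes> (\<sigma> ^^ n) k" if b: "b \<in> carrier D" for b
  proof -
    obtain a where "a \<in> carrier D" "b = (\<sigma> ^^ n) a"
      using b sigma_pow_bij[of n] by (auto simp: bij_betw_def)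
    then show ?thesis
      using k center_comm[OF k] by (simp add: center_closed flip: sigma_pow_mult)
  qed
  then show ?thesis
    using k by (intro centerI) (simp_all add: center_closed)
qed

abbreviation c :: "nat \<Rightarrow> 'a \<Rightarrow> 'a" where "c \<equiv> orbit_prod D \<sigma>"

abbreviation S0 where "S0 \<equiv> fixed_center_ring D \<sigma>"

abbreviation A where "A \<equiv> gen_cyclic_algebra D \<sigma> m d"

lemma orbit_prod_0 [simp]: "c 0 k = \<one>"
proof -
  interpret C: cring "center_ring D" by (rule cring_center_ring)
  show ?thesis by (simp add: orbit_prod_def)
qed

lemma orbit_prod_center [simp]: "k \<in> center D \<Longrightarrow> c n k \<in> center D"
proof -
  interpret C: cring "center_ring D" by (rule cring_center_ring)
  assume "k \<in> center D"
  then show ?thesis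
    using C.finprod_closed[of "\<lambda>l. (\<sigma> ^^ l) k" "{..<n}"] by (simp add: orbit_prod_def Pi_def)
qed

lemma orbit_prod_closed [simp]: "k \<in> center D \<Longrightarrow> c n k \<in> carrier D"
  by (simp add: center_closed)

lemma orbit_prod_Suc: "k \<in> center D \<Longrightarrow> c (Suc n) k = c n k \<otimes> (\<sigma> ^^ n) k"
proof -
  interpret C: cring "center_ring D" by (rule cring_center_ring)
  assume k: "k \<in> center D"
  have "c (Suc n) k = (\<sigma> ^^ n) k \<otimes> c n k"
    using k C.finprod_insert[of "{..<n}" n "\<lambda>l. (\<sigma> ^^ l) k"]
    by (simp add: orbit_prod_def lessThan_Suc Pi_def)
  then show ?thesis
    using center_comm[OF sigma_pow_center[OF k] orbit_prod_closed[OF k]] by simp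
qed

lemma orbit_prod_1: "k \<in> center D \<Longrightarrow> c (Suc 0) k = k"
  by (simp add: orbit_prod_Suc center_closed)

text \<open>The cocycle identity for the orbit products. It is what makes \<open>H\<close>
  multiplicative before reduction modulo t^m - d.\<close>

lemma orbit_prod_add: "k \<in> center D \<Longrightarrow> c (i + j) k = c i k \<otimes> (\<sigma> ^^ i) (c j k)"
  by (induction j) (simp_all add: orbit_prod_Suc sigma_pow_mult center_closed m_assoc sigma_pow_add_pow)

lemma orbit_prod_one [simp]: "c n \<one> = \<one>"
  by (induction n) (simp_all add: orbit_prod_Suc center_one)

lemma orbit_prod_mult:
  "k \<in> center D \<Longrightarrow> l \<in> center D \<Longrightarrow> c n (k \<otimes> l) = c n k \<otimes> c n l"
proof -
  interpret C: cring "center_ring D" by (rule cring_center_ring)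
  assume "k \<in> center D" "l \<in> center D"
  then show ?thesis
    using C.finprod_multf[of "\<lambda>j. (\<sigma> ^^ j) k" "{..<n}" "\<lambda>j. (\<sigma> ^^ j) l"]
    by (simp add: orbit_prod_def Pi_def sigma_pow_mult center_closed)
qed

lemma orbit_prod_unit:
  assumes "k \<in> Units (center_ring D)"
  shows "c n k \<in> Units (center_ring D)"
proof -
  interpret C: cring "center_ring D" by (rule cring_center_ring)
  let ?k' = "inv\<^bsub>center_ring D\<^esub> k"
  have k: "k \<in> center D" "?k' \<in> center D"
    using assms C.Units_closed C.Units_inv_closed by auto
  have "c n k \<otimes> c n ?k' = \<one>"
    using k C.Units_r_inv[OF assms] by (simp flip: orbit_prod_mult)
  moreover have "c n ?k' \<otimes> c n k = \<one>"
    using k C.Units_l_inv[OF assms] by (simp flip: orbit_prod_mult)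
  ultimately show ?thesis
    using k by (auto simp: Units_def)
qed

lemma fixed_sigma_pow: "\<sigma> a = a \<Longrightarrow> (\<sigma> ^^ n) a = a"
  by (induction n) simp_all

text \<open>All factors coincide when \<open>\<sigma>\<close> fixes \<open>a\<close>. For n = m the
  norm of an m-th root of unity in \<open>S0\<close> is thus 1.\<close>

lemma orbit_prod_fixed: "a \<in> carrier S0 \<Longrightarrow> c n a = a [^] n"
  by (induction n) (simp_all add: orbit_prod_Suc fixed_sigma_pow)

text \<open>
  Surjectivity of the Galois map gives \<open>x\<^sub>l\<close>, \<open>y\<^sub>l\<close> in \<open>C\<close> such that \<open>\<Sum> x\<^sub>l \<sigma>\<^sup>j(y\<^sub>l)\<close> is \<open>1\<close>
  for \<open>j = 1\<close> and \<open>0\<close> for \<open>j = i\<close>; both sums agree after multiplication by \<open>w\<close>. The subgroup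
  \<open>Q\<close> in the proof expresses this without choosing \<open>x\<^sub>l\<close>, \<open>y\<^sub>l\<close>.
\<close>

lemma galois_intertwiner_zero:
  assumes galois: "cyclic_galois_extension S0 (center_ring D) \<sigma> m"
    and w: "w \<in> carrier D" and i: "i < m" "i \<noteq> 1"
    and comm: "\<And>y. y \<in> center D \<Longrightarrow> w \<otimes> (\<sigma> ^^ i) y = w \<otimes> \<sigma> y"
  shows "w = \<zero>"
proof -
  interpret C: cring "center_ring D" by (rule cring_center_ring)
  define P where "P = product_algebra (center_ring D) {..<m}"
  define \<phi> where "\<phi> = (\<lambda>x y. \<lambda>j\<in>{..<m}. x \<otimes> (\<sigma> ^^ j) y)"
  define L where "L = tensor_lift (add_monoid P) \<phi>"
  let ?C = "self_algebra (center_ring D)"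
  let ?F = "free_Abelian_group (center D \<times> center D)"
  note C_simps = C.a_ac[simplified] C.a_closed[simplified]
    C.zero_closed[simplified] C.l_zero[simplified] C.r_zero[simplified]
  have P_group: "comm_group (add_monoid P)"
  proof (rule comm_groupI)
    fix x assume x: "x \<in> carrier (add_monoid P)"
    let ?y = "\<lambda>j\<in>{..<m}. \<ominus>\<^bsub>center_ring D\<^esub> x j"
    have "?y \<in> carrier (add_monoid P)"
      using x C.a_inv_closed by (auto simp: P_def product_algebra_def PiE_def Pi_def)
    moreover have "?y \<otimes>\<^bsub>add_monoid P\<^esub> x = \<one>\<^bsub>add_monoid P\<^esub>"
      using x C.l_neg by (auto simp: P_def product_algebra_def PiE_def Pi_def fun_eq_iff)
    ultimately show "\<exists>y\<in>carrier (add_monoid P). y \<otimes>\<^bsub>add_monoid P\<^esub> x = \<one>\<^bsub>add_monoid P\<^esub>"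
      by blast
  qed (auto simp: P_def product_algebra_def C_simps PiE_def Pi_def fun_eq_iff restrict_def extensional_def)
  interpret P: comm_group "add_monoid P" by (rule P_group)
  have \<phi>_closed: "\<phi> x y \<in> carrier P" if "x \<in> center D" "y \<in> center D" for x y
    using that by (auto simp: P_def \<phi>_def product_algebra_def center_m_closed)
  have "L \<in> ring_iso (tensor_algebra S0 ?C ?C) P"
    using galois by (simp add: cyclic_galois_extension_def L_def P_def \<phi>_def)
  \<comment> \<open>The idempotent of the coordinate j = 1; its preimage under the Galois map is the
    tensor that separates \<open>\<sigma>\<close> from \<open>\<sigma> ^^ i\<close>.\<close>
  moreover have "(\<lambda>j\<in>{..<m}. if j = 1 then \<one> else \<zero>) \<in> carrier P" (is "?\<delta> \<in> _")
    using C.zero_closed by (auto simp: P_def product_algebra_def center_one)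
  ultimately have "?\<delta> \<in> L ` carrier (tensor_algebra S0 ?C ?C)"
    by (simp add: ring_iso_def bij_betw_def)
  then obtain U where U: "U \<in> carrier (tensor_algebra S0 ?C ?C)" "L U = ?\<delta>"
    by force
  then obtain z where z: "z \<in> carrier ?F" "U = tensor_kernel S0 ?C ?C #>\<^bsub>?F\<^esub> z"
    by (auto simp: tensor_algebra_def tensor_group_def FactGroup_def RCOSETS_def)
  have \<phi>_addl: "\<phi> (x \<oplus> x') y = \<phi> x y \<oplus>\<^bsub>P\<^esub> \<phi> x' y"
    if "x \<in> center D" "x' \<in> center D" "y \<in> center D" for x x' y
    using that by (simp add: \<phi>_def P_def product_algebra_def fun_eq_iff center_closed l_distr)
  have \<phi>_addr: "\<phi> x (y \<oplus> y') = \<phi> x y \<oplus>\<^bsub>P\<^esub> \<phi> x y'"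
    if "x \<in> center D" "y \<in> center D" "y' \<in> center D" for x y y'
    using that by (simp add: \<phi>_def P_def product_algebra_def fun_eq_iff center_closed r_distr sigma_pow_add)
  \<comment> \<open>Balancedness over \<open>S0\<close> holds because every
    \<open>\<sigma> ^^ j\<close> fixes \<open>r\<close>.\<close>
  have \<phi>_bal: "\<phi> (r \<otimes> x) y = \<phi> x (r \<otimes> y)"
    if "r \<in> carrier S0" "x \<in> center D" "y \<in> center D" for r x y
  proof -
    have "r \<otimes> x = x \<otimes> r"
      using that center_comm[of r D x] by (simp add: center_closed)
    then show ?thesis
      using that by (simp add: \<phi>_def center_closed sigma_pow_mult fixed_sigma_pow m_assoc)
  qed
  have "L U = finprod (add_monoid P)
      (\<lambda>(x, y). \<phi> x y [^]\<^bsub>add_monoid P\<^esub> Poly_Mapping.lookup z (x, y)) (Poly_Mapping.keys z)"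
    unfolding L_def z(2)
    using z(1) \<phi>_closed \<phi>_addl \<phi>_addr \<phi>_bal C.a_closed center_m_closed
    by (intro P.tensor_lift_coset[where M = ?C and N = ?C, simplified]) auto
  moreover have "\<dots> \<in> {p \<in> carrier P. w \<otimes> p i = w \<otimes> p 1}" (is "_ \<in> ?Q")
  proof (rule P.finprod_subgroup_closed)
    have nth: "p j \<in> center D" if "p \<in> carrier P" "j < m" for p j
      using that by (auto simp: P_def product_algebra_def)
    have m1: "1 < m"
      using m_ge_2 by simp
    show Q: "subgroup ?Q (add_monoid P)"
    proof (rule P.subgroupI)
      fix a assume a: "a \<in> ?Q"
      let ?b = "inv\<^bsub>add_monoid P\<^esub> a"
      have b: "?b \<in> carrier P"
        using a P.inv_closed by simp
      have "w \<otimes> ?b j = \<ominus> (w \<otimes> a j)" if j: "j < m" for j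
      proof -
        have aj: "a j \<in> carrier D" and bj: "?b j \<in> carrier D"
          using nth[of a j] nth[of ?b j] a b j by (simp_all add: center_closed)
        have "(?b \<oplus>\<^bsub>P\<^esub> a) j = \<zero>\<^bsub>P\<^esub> j"
          using P.l_inv[of a] a by simp
        then have "?b j \<oplus> a j = \<zero>"
          using j by (simp add: P_def product_algebra_def)
        then have "?b j = \<ominus> a j"
          using aj bj by (simp add: minus_equality)
        then show ?thesis
          using aj w by (simp add: r_minus)
      qed
      then show "?b \<in> ?Q"
        using a b i m1 by simp
    next
      fix a b assume ab: "a \<in> ?Q" "b \<in> ?Q"
      have "(a \<oplus>\<^bsub>P\<^esub> b) j = a j \<oplus> b j" if "j < m" for j
        using that by (simp add: P_def product_algebra_def)
      moreover have "a \<oplus>\<^bsub>P\<^esub> b \<in> carrier P"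
        using P.m_closed[of a b] ab by simp
      ultimately show "a \<otimes>\<^bsub>add_monoid P\<^esub> b \<in> ?Q"
        using ab i m1 w nth by (simp add: r_distr center_closed)
    next
      have "\<zero>\<^bsub>P\<^esub> \<in> ?Q"
        using P.one_closed i m1 by (simp add: P_def product_algebra_def)
      then show "?Q \<noteq> {}"
        by blast
    qed auto
    \<comment> \<open>The central factor \<open>x\<close> moves in front of \<open>w\<close>; then
      \<open>comm\<close> identifies the coordinates \<open>i\<close> and 1.\<close>
    have "\<phi> x y \<in> ?Q" if xy: "x \<in> center D" "y \<in> center D" for x y
    proof -
      have swap: "w \<otimes> (x \<otimes> (\<sigma> ^^ j) y) = x \<otimes> (w \<otimes> (\<sigma> ^^ j) y)" for j
        using xy w by (simp add: center_closed center_comm[of x, symmetric] flip: m_assoc)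
      then show ?thesis
        using xy comm[of y] i m1 \<phi>_closed[OF xy] swap[of i] swap[of 1] by (simp add: \<phi>_def)
    qed
    then have "\<phi> x y [^]\<^bsub>add_monoid P\<^esub> n \<in> ?Q" if "x \<in> center D" "y \<in> center D" for x y and n :: int
      using that by (intro P.subgroup_int_pow_closed[OF Q])
    then show "(\<lambda>(x, y). \<phi> x y [^]\<^bsub>add_monoid P\<^esub> Poly_Mapping.lookup z (x, y))
        \<in> Poly_Mapping.keys z \<rightarrow> ?Q"
      using subsetD[OF z(1)[unfolded carrier_free_Abelian_group_iff]]
      by (intro Pi_I) (simp del: mem_Collect_eq add: case_prod_unfold mem_Times_iff)
  qed
  \<comment> \<open>Coordinate \<open>i\<close> of \<open>?\<delta>\<close> is 0 because
    \<open>i \<noteq> 1\<close>, and coordinate 1 is \<open>\<one>\<close>, so this equation says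
    that \<open>w\<close> is zero.\<close>
  ultimately have "w \<otimes> ?\<delta> i = w \<otimes> ?\<delta> 1"
    using U(2) by simp
  then show ?thesis
    using i w m_ge_2 by simp
qed

end

section \<open>Multiplication in the generalized cyclic algebra\<close>

lemma skew_poly_ring_simps [simp]:
  "carrier (skew_poly_ring D \<sigma>) = up D"
  "p \<otimes>\<^bsub>skew_poly_ring D \<sigma>\<^esub> q = (\<lambda>n. \<Oplus>\<^bsub>D\<^esub>i\<in>{..n}. p i \<otimes>\<^bsub>D\<^esub> (\<sigma> ^^ i) (q (n - i)))"
  "\<one>\<^bsub>skew_poly_ring D \<sigma>\<^esub> = skew_monom D \<one>\<^bsub>D\<^esub> 0"
  "\<zero>\<^bsub>skew_poly_ring D \<sigma>\<^esub> = (\<lambda>i. \<zero>\<^bsub>D\<^esub>)"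
  "p \<oplus>\<^bsub>skew_poly_ring D \<sigma>\<^esub> q = (\<lambda>i. p i \<oplus>\<^bsub>D\<^esub> q i)"
  by (simp_all add: skew_poly_ring_def)

lemma (in ring) skew_poly_abelian_group: "abelian_group (skew_poly_ring R f)"
proof (rule abelian_groupI)
  fix p assume p: "p \<in> carrier (skew_poly_ring R f)"
  then show "\<exists>q\<in>carrier (skew_poly_ring R f). q \<oplus>\<^bsub>skew_poly_ring R f\<^esub> p = \<zero>\<^bsub>skew_poly_ring R f\<^esub>"
    by (intro bexI[of _ "\<lambda>i. \<ominus> p i"]) (auto simp: up_a_inv_closed l_neg mem_upD)
qed (auto simp: fun_eq_iff a_ac mem_upD up_add_closed)

lemma (in ring) skew_monom_up: "a \<in> carrier R \<Longrightarrow> skew_monom R a n \<in> up R"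
  by (auto simp: skew_monom_def up_def)

text \<open>Subtraction of skew polynomials is defined through an abstract additive inverse, which
  the group structure identifies coefficientwise. The assumption \<open>0 < n\<close> keeps the
  exponents of the two monomials apart.\<close>

lemma (in ring) binomial_poly_eq:
  assumes "0 < n" "a \<in> carrier R"
  shows "binomial_poly R f n a = (\<lambda>i. if i = n then \<one> else if i = 0 then \<ominus> a else \<zero>)"
proof -
  interpret S: abelian_group "skew_poly_ring R f" by (rule skew_poly_abelian_group)
  have "\<ominus>\<^bsub>skew_poly_ring R f\<^esub> skew_monom R a 0 = skew_monom R (\<ominus> a) 0"
    by (rule S.minus_equality) (use assms in \<open>auto simp: skew_monom_up\<close>, auto simp: skew_monom_def l_neg)
  then show ?thesis
    using assms by (auto simp: binomial_poly_def a_minus_def skew_monom_def)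
qed

context skew_cyclic
begin

section \<open>Right division by t^m - d\<close>

lemma polys_below_iff:
  "g \<in> polys_below D m \<longleftrightarrow> (\<forall>i. g i \<in> carrier D) \<and> (\<forall>i\<ge>m. g i = \<zero>)"
  by (auto simp: polys_below_def up_def intro!: exI[of _ m])

lemma polys_below_nth [simp]: "g \<in> polys_below D m \<Longrightarrow> g i \<in> carrier D"
  by (simp add: polys_below_iff)

lemma polys_below_zero: "g \<in> polys_below D m \<Longrightarrow> i \<ge> m \<Longrightarrow> g i = \<zero>"
  by (simp add: polys_below_iff)

text \<open>The factor t^m shifts the coefficients of \<open>q\<close> by m, and moving d past t^n
  turns it into \<open>(\<sigma> ^^ n) d\<close>.\<close>

lemma mult_binomial_poly:
  assumes q: "q \<in> up D"
  shows "(q \<otimes>\<^bsub>skew_poly_ring D \<sigma>\<^esub> binomial_poly D \<sigma> m d) n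
    = (if m \<le> n then q (n - m) else \<zero>) \<ominus> q n \<otimes> (\<sigma> ^^ n) d"
proof -
  have q' [simp]: "q i \<in> carrier D" for i
    using q by auto
  have m: "0 < m"
    using m_ge_2 by simp
  have neg: "(\<sigma> ^^ n) (\<ominus> d) = \<ominus> (\<sigma> ^^ n) d"
    using sigma_pow_add[of "\<ominus> d" d n] by (simp add: l_neg minus_equality)
  have "(q \<otimes>\<^bsub>skew_poly_ring D \<sigma>\<^esub> binomial_poly D \<sigma> m d) n
      = (\<Oplus>i\<in>{..n}. (if n - m = i then (if m \<le> n then q i else \<zero>) else \<zero>)
          \<oplus> (if n = i then \<ominus> (q i \<otimes> (\<sigma> ^^ i) d) else \<zero>))"
    unfolding skew_poly_ring_simps binomial_poly_eq[OF m d_closed]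
    by (rule finsum_cong') (use m neg in \<open>auto simp: r_minus\<close>)
  also have "\<dots> = (if m \<le> n then q (n - m) else \<zero>) \<oplus> \<ominus> (q n \<otimes> (\<sigma> ^^ n) d)"
    by (subst finsum_addf) (auto simp: finsum_singleton)
  finally show ?thesis
    by (simp add: a_minus_def)
qed

text \<open>One division step suffices in degree below 2m: the coefficients from index m on, shifted
  down by m, form the quotient \<open>?q\<close>, and each p(n+m) t^n d contributes
  \<open>p (n + m) \<otimes> (\<sigma> ^^ n) d\<close> to the remainder.\<close>

lemma right_remainder_eq:
  assumes p: "\<And>n. p n \<in> carrier D" "\<And>n. n \<ge> 2 * m \<Longrightarrow> p n = \<zero>"
  shows "right_remainder D \<sigma> m d p
    = (\<lambda>n. if n < m then p n \<oplus> p (n + m) \<otimes> (\<sigma> ^^ n) d else \<zero>)" (is "_ = ?r")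
proof -
  let ?S = "skew_poly_ring D \<sigma>"
  let ?f = "binomial_poly D \<sigma> m d"
  let ?P = "\<lambda>r. r \<in> polys_below D m \<and> (\<exists>q\<in>carrier ?S. p = q \<otimes>\<^bsub>?S\<^esub> ?f \<oplus>\<^bsub>?S\<^esub> r)"
  let ?q = "\<lambda>n. if n < m then p (n + m) else \<zero>"
  have q: "?q \<in> up D"
    using p by (auto simp: up_def intro!: exI[of _ m])
  have "p n = (?q \<otimes>\<^bsub>?S\<^esub> ?f) n \<oplus> ?r n" for n
    unfolding mult_binomial_poly[OF q]
  proof (cases "n < m")
    case True
    then show "p n = ((if m \<le> n then ?q (n - m) else \<zero>) \<ominus> ?q n \<otimes> (\<sigma> ^^ n) d) \<oplus> ?r n"
      using p by (simp add: a_minus_def a_ac r_neg)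
  next
    case False
    then show "p n = ((if m \<le> n then ?q (n - m) else \<zero>) \<ominus> ?q n \<otimes> (\<sigma> ^^ n) d) \<oplus> ?r n"
      using p by (simp add: a_minus_def)
  qed
  then have "p = ?q \<otimes>\<^bsub>?S\<^esub> ?f \<oplus>\<^bsub>?S\<^esub> ?r"
    by (simp add: fun_eq_iff)
  then have "?P ?r"
    using q p by (auto simp: polys_below_iff simp del: skew_poly_ring_simps(2,5))
  moreover have "r = ?r" if r: "?P r" for r
  proof -
    obtain q where q: "q \<in> up D" and pq: "p = q \<otimes>\<^bsub>?S\<^esub> ?f \<oplus>\<^bsub>?S\<^esub> r"
      using r by auto
    have q' [simp]: "q i \<in> carrier D" and r' [simp]: "r i \<in> carrier D" for i
      using q r by auto
    have p_eq: "p n = (if m \<le> n then q (n - m) else \<zero>) \<ominus> q n \<otimes> (\<sigma> ^^ n) d \<oplus> r n" for n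
      using pq mult_binomial_poly[OF q, of n] by (simp add: fun_eq_iff)
    \<comment> \<open>Comparison of the coefficients at n + m, where \<open>r\<close> vanishes,
      expresses each coefficient of a quotient by one that lies m places higher.\<close>
    have step: "q n = p (n + m) \<oplus> q (n + m) \<otimes> (\<sigma> ^^ (n + m)) d" for n
      using p_eq[of "n + m"] r by (simp add: polys_below_iff a_minus_def a_assoc l_neg)
    obtain N where N: "\<And>n. N < n \<Longrightarrow> q n = \<zero>"
      using q by (auto simp: up_def bound_def)
    \<comment> \<open>Downward induction from the degree bound \<open>N\<close> of \<open>q\<close>:
      for n at least m also \<open>p (n + m) = \<zero>\<close>, so \<open>step\<close> carries the
      vanishing of \<open>q (n + m)\<close> down to \<open>q n\<close>. The number j measures the
      distance below \<open>N\<close>.\<close>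
    have "q n = \<zero>" if "n \<ge> m" for n
    proof -
      have "\<forall>n\<ge>m. N < n + j \<longrightarrow> q n = \<zero>" for j
      proof (induction j)
        case (Suc j)
        show ?case
        proof (intro allI impI)
          fix n assume n: "m \<le> n" "N < n + Suc j"
          then have "q (n + m) = \<zero>"
            using Suc m_ge_2 by simp
          then show "q n = \<zero>"
            using step[of n] n p by simp
        qed
      qed (use N in simp)
      from this[of "Suc N"] show ?thesis
        using that by simp
    qed
    then have "q n = p (n + m)" for n
      using step[of n] p by simp
    then have "p n = \<ominus> (p (n + m) \<otimes> (\<sigma> ^^ n) d) \<oplus> r n" if "n < m" for n
      using p_eq[of n] that p by (simp add: a_minus_def)
    then have "p n \<oplus> p (n + m) \<otimes> (\<sigma> ^^ n) d = r n" if "n < m" for n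
      using that p(1) by (metis a_comm m_closed r' sigma_pow_closed d_closed r_neg2)
    then show ?thesis
      using r by (auto simp: polys_below_iff fun_eq_iff)
  qed
  ultimately show ?thesis
    unfolding right_remainder_def by (intro the_equality)
qed

section \<open>Products before and after reduction, by coefficients\<close>

definition conv :: "(nat \<Rightarrow> 'a) \<Rightarrow> (nat \<Rightarrow> 'a) \<Rightarrow> nat \<Rightarrow> 'a" where
  "conv g h n = (\<Oplus>i\<in>{..n}. g i \<otimes> (\<sigma> ^^ i) (h (n - i)))"

lemma conv_closed [simp]:
  "g \<in> polys_below D m \<Longrightarrow> h \<in> polys_below D m \<Longrightarrow> conv g h n \<in> carrier D"
  unfolding conv_def by (rule finsum_closed) simp

text \<open>In every summand either i or n - i is at least m, so one of the two factors
  vanishes.\<close>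

lemma conv_zero:
  assumes "g \<in> polys_below D m" "h \<in> polys_below D m" "n \<ge> 2 * m"
  shows "conv g h n = \<zero>"
proof -
  have "g i \<otimes> (\<sigma> ^^ i) (h (n - i)) = \<zero>" for i
    using assms by (cases "i < m") (simp_all add: polys_below_iff)
  then show ?thesis
    by (simp add: conv_def)
qed

lemma gen_cyclic_simps [simp]:
  "carrier A = polys_below D m"
  "\<one>\<^bsub>A\<^esub> = skew_monom D \<one> 0"
  "\<zero>\<^bsub>A\<^esub> = (\<lambda>i. \<zero>)"
  "g \<oplus>\<^bsub>A\<^esub> h = (\<lambda>i. g i \<oplus> h i)"
  "s \<odot>\<^bsub>A\<^esub> g = (\<lambda>i. s \<otimes> g i)"
  by (simp_all add: gen_cyclic_algebra_def)

lemma gen_cyclic_mult: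
  assumes "g \<in> polys_below D m" "h \<in> polys_below D m"
  shows "g \<otimes>\<^bsub>A\<^esub> h
    = (\<lambda>n. if n < m then conv g h n \<oplus> conv g h (n + m) \<otimes> (\<sigma> ^^ n) d else \<zero>)"
proof -
  have "g \<otimes>\<^bsub>A\<^esub> h = right_remainder D \<sigma> m d (conv g h)"
    by (simp add: gen_cyclic_algebra_def conv_def[abs_def])
  also have "\<dots> = (\<lambda>n. if n < m then conv g h n \<oplus> conv g h (n + m) \<otimes> (\<sigma> ^^ n) d else \<zero>)"
    by (rule right_remainder_eq) (use assms in \<open>simp_all add: conv_zero\<close>)
  finally show ?thesis .
qed

lemma gen_cyclic_mult_closed:
  "g \<in> polys_below D m \<Longrightarrow> h \<in> polys_below D m \<Longrightarrow> g \<otimes>\<^bsub>A\<^esub> h \<in> polys_below D m"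
  by (simp add: gen_cyclic_mult polys_below_iff[of "\<lambda>n. _ n"])

lemma skew_monom_below [simp]: "a \<in> carrier D \<Longrightarrow> n < m \<Longrightarrow> skew_monom D a n \<in> polys_below D m"
  by (auto simp: polys_below_iff skew_monom_def)

lemma conv_skew_monom_left:
  assumes "a \<in> carrier D" "h \<in> polys_below D m"
  shows "conv (skew_monom D a j) h n = (if j \<le> n then a \<otimes> (\<sigma> ^^ j) (h (n - j)) else \<zero>)"
proof -
  have "conv (skew_monom D a j) h n
      = (\<Oplus>i\<in>{..n}. if j = i then a \<otimes> (\<sigma> ^^ i) (h (n - i)) else \<zero>)"
    unfolding conv_def by (rule finsum_cong') (use assms in \<open>auto simp: skew_monom_def\<close>)
  also have "\<dots> = (if j \<le> n then a \<otimes> (\<sigma> ^^ j) (h (n - j)) else \<zero>)"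
  proof (cases "j \<le> n")
    case True
    then show ?thesis
      using assms by (subst finsum_singleton) auto
  next
    case False
    then have "(\<Oplus>i\<in>{..n}. if j = i then a \<otimes> (\<sigma> ^^ i) (h (n - i)) else \<zero>) = (\<Oplus>i\<in>{..n}. \<zero>)"
      using assms by (intro finsum_cong') auto
    then show ?thesis
      using False by simp
  qed
  finally show ?thesis .
qed

lemma conv_skew_monom_right:
  assumes "a \<in> carrier D" "g \<in> polys_below D m"
  shows "conv g (skew_monom D a 0) n = g n \<otimes> (\<sigma> ^^ n) a"
proof -
  have "conv g (skew_monom D a 0) n
      = (\<Oplus>i\<in>{..n}. if n = i then g i \<otimes> (\<sigma> ^^ i) a else \<zero>)"
    unfolding conv_def by (rule finsum_cong') (use assms in \<open>auto simp: skew_monom_def\<close>)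
  then show ?thesis
    using assms by (subst (asm) finsum_singleton) auto
qed

text \<open>Moving b past t^i applies \<open>\<sigma> ^^ i\<close>. If the degree reaches m, then
  t^(i+j) = t^(i+j-m) t^m is replaced by t^(i+j-m) d, and d in turn moves to the left.\<close>

lemma mult_monom_monom:
  assumes "a \<in> carrier D" "b \<in> carrier D" "i < m" "j < m"
  shows "skew_monom D a i \<otimes>\<^bsub>A\<^esub> skew_monom D b j
    = (if i + j < m then skew_monom D (a \<otimes> (\<sigma> ^^ i) b) (i + j)
       else skew_monom D (a \<otimes> (\<sigma> ^^ i) b \<otimes> (\<sigma> ^^ (i + j - m)) d) (i + j - m))"
  using assms
  by (simp add: gen_cyclic_mult conv_skew_monom_left cong: if_cong) (auto simp: fun_eq_iff skew_monom_def)

lemma mult_const_right: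
  assumes "a \<in> carrier D" "g \<in> polys_below D m"
  shows "g \<otimes>\<^bsub>A\<^esub> skew_monom D a 0 = (\<lambda>n. g n \<otimes> (\<sigma> ^^ n) a)"
  using assms m_ge_2
  by (auto simp: gen_cyclic_mult conv_skew_monom_right fun_eq_iff polys_below_zero)

lemma mult_const_left:
  assumes "a \<in> carrier D" "g \<in> polys_below D m"
  shows "skew_monom D a 0 \<otimes>\<^bsub>A\<^esub> g = (\<lambda>n. a \<otimes> g n)"
  using assms m_ge_2
  by (auto simp: gen_cyclic_mult conv_skew_monom_left fun_eq_iff polys_below_zero)

end

section \<open>The automorphisms \<open>H(\<tau>, k)\<close>\<close>

lemma mem_algebra_autos_iff:
  "f \<in> algebra_autos R A \<longleftrightarrow> f \<in> Bij (carrier A) \<and>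
    (\<forall>x\<in>carrier A. \<forall>y\<in>carrier A. f (x \<otimes>\<^bsub>A\<^esub> y) = f x \<otimes>\<^bsub>A\<^esub> f y \<and> f (x \<oplus>\<^bsub>A\<^esub> y) = f x \<oplus>\<^bsub>A\<^esub> f y) \<and>
    f \<one>\<^bsub>A\<^esub> = \<one>\<^bsub>A\<^esub> \<and> (\<forall>r\<in>carrier R. \<forall>x\<in>carrier A. f (r \<odot>\<^bsub>A\<^esub> x) = r \<odot>\<^bsub>A\<^esub> f x)"
  using Bij_imp_funcset[of f "carrier A"]
  by (auto simp: algebra_autos_def ring_iso_def ring_hom_def linear_maps_def hom_def Bij_def)

text \<open>Only closure of the operations is recorded, because the generalized cyclic algebra need
  not be associative and so does not fit the ring locales. Closure is enough to make the
  automorphisms a subgroup of the bijections.\<close>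

locale algebra_ops =
  fixes R :: "('r, 'c) ring_scheme" and A :: "('r, 'a, 'd) module_scheme"
  assumes one_mem: "\<one>\<^bsub>A\<^esub> \<in> carrier A"
    and mult_mem: "\<And>x y. x \<in> carrier A \<Longrightarrow> y \<in> carrier A \<Longrightarrow> x \<otimes>\<^bsub>A\<^esub> y \<in> carrier A"
    and add_mem: "\<And>x y. x \<in> carrier A \<Longrightarrow> y \<in> carrier A \<Longrightarrow> x \<oplus>\<^bsub>A\<^esub> y \<in> carrier A"
    and smult_mem: "\<And>r x. r \<in> carrier R \<Longrightarrow> x \<in> carrier A \<Longrightarrow> r \<odot>\<^bsub>A\<^esub> x \<in> carrier A"
begin

lemma subgroup_algebra_autos: "subgroup (algebra_autos R A) (BijGroup (carrier A))"
proof -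
  interpret B: group "BijGroup (carrier A)" by (rule group_BijGroup)
  let ?id = "\<lambda>x\<in>carrier A. x"
  have id: "?id \<in> algebra_autos R A"
    by (simp add: mem_algebra_autos_iff id_Bij one_mem mult_mem add_mem smult_mem)
  show ?thesis
  proof (rule B.subgroupI)
    show "algebra_autos R A \<subseteq> carrier (BijGroup (carrier A))"
      by (auto simp: BijGroup_def mem_algebra_autos_iff)
    show "algebra_autos R A \<noteq> {}"
      using id by blast
    fix f assume f: "f \<in> algebra_autos R A"
    then have Bij: "f \<in> Bij (carrier A)"
      by (simp add: mem_algebra_autos_iff)
    let ?g = "inv_into (carrier A) f"
    have bij: "bij_betw f (carrier A) (carrier A)"
      using Bij by (simp add: Bij_def)
    have g: "?g y \<in> carrier A" "f (?g y) = y" if "y \<in> carrier A" for y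
      using bij that by (auto simp: bij_betw_def inv_into_into f_inv_into_f)
    \<comment> \<open>The inverse respects an operation once \<open>f\<close> sends the expected
      value to the argument; this reduces each claim to the corresponding one for
      \<open>f\<close>.\<close>
    have gI: "?g y = x" if "x \<in> carrier A" "f x = y" for x y
      using bij that by (auto simp: bij_betw_def)
    have "restrict ?g (carrier A) \<in> algebra_autos R A"
      unfolding mem_algebra_autos_iff
    proof (intro conjI ballI)
      show "restrict ?g (carrier A) \<in> Bij (carrier A)"
        using Bij by (rule restrict_inv_into_Bij)
    qed (use f in \<open>auto simp: mem_algebra_autos_iff one_mem mult_mem add_mem smult_mem g intro!: gI\<close>)
    then show "inv\<^bsub>BijGroup (carrier A)\<^esub> f \<in> algebra_autos R A"
      by (simp add: inv_BijGroup[OF Bij])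
  next
    fix f g assume fg: "f \<in> algebra_autos R A" "g \<in> algebra_autos R A"
    then have Bij: "f \<in> Bij (carrier A)" "g \<in> Bij (carrier A)"
      by (simp_all add: mem_algebra_autos_iff)
    have "g x \<in> carrier A" if "x \<in> carrier A" for x
      using Bij_imp_funcset[OF Bij(2)] that by auto
    then have "compose (carrier A) f g \<in> algebra_autos R A"
      using fg by (auto simp: mem_algebra_autos_iff compose_Bij compose_eq one_mem mult_mem add_mem smult_mem)
    then show "f \<otimes>\<^bsub>BijGroup (carrier A)\<^esub> g \<in> algebra_autos R A"
      using Bij by (simp add: BijGroup_def)
  qed
qed

lemma group_algebra_auto_group: "group (algebra_auto_group R A)"
  unfolding algebra_auto_group_def
  by (rule subgroup.subgroup_is_group[OF subgroup_algebra_autos group_BijGroup])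

end

lemma algebra_auto_group_simps [simp]:
  "carrier (algebra_auto_group R A) = algebra_autos R A"
  "\<one>\<^bsub>algebra_auto_group R A\<^esub> = (\<lambda>x\<in>carrier A. x)"
  by (simp_all add: algebra_auto_group_def BijGroup_def)

lemma algebra_auto_group_mult:
  "f \<in> algebra_autos R A \<Longrightarrow> g \<in> algebra_autos R A
    \<Longrightarrow> f \<otimes>\<^bsub>algebra_auto_group R A\<^esub> g = compose (carrier A) f g"
  by (simp add: algebra_auto_group_def BijGroup_def mem_algebra_autos_iff)

context skew_cyclic
begin

abbreviation AutD where "AutD \<equiv> algebra_auto_group S0 (self_algebra D)"

abbreviation AutA where "AutA \<equiv> algebra_auto_group S0 A"

abbreviation H where "H \<equiv> H_map D \<sigma> m"

abbreviation idD :: "'a \<Rightarrow> 'a" where "idD \<equiv> \<lambda>x\<in>carrier D. x"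

sublocale AutD: group AutD
  by (intro algebra_ops.group_algebra_auto_group algebra_ops.intro) auto

sublocale AutA: group AutA
proof (intro algebra_ops.group_algebra_auto_group algebra_ops.intro)
  show "\<one>\<^bsub>A\<^esub> \<in> carrier A"
    using m_ge_2 by simp
qed (simp_all add: gen_cyclic_mult_closed, simp_all add: polys_below_iff)

lemma idD_auto: "idD \<in> carrier AutD"
  using AutD.one_closed by simp

section \<open>Multiplicativity, bijectivity and composition of the maps
  \<open>H \<tau> k\<close>\<close>

lemma H_below: 
  assumes "\<tau> \<in> carrier AutD" "k \<in> center D" "a \<in> polys_below D m"
  shows "H \<tau> k a \<in> polys_below D m"
proof -
  have "\<tau> x \<in> carrier D" if "x \<in> carrier D" for x
    using assms(1) that by (auto simp: algebra_autos_def ring_iso_def ring_hom_def)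
  moreover have "\<tau> \<zero> = \<zero>"
    using ring_hom_zero[OF _ ring_axioms ring_axioms, of \<tau>] assms(1)
    by (auto simp: algebra_autos_def ring_iso_def ring_hom_def)
  ultimately show ?thesis
    using assms by (simp add: H_map_def polys_below_iff)
qed

lemma H_nth: "a \<in> polys_below D m \<Longrightarrow> H \<tau> k a i = \<tau> (a i) \<otimes> c i k"
  by (simp add: H_map_def)

text \<open>In each summand the central \<open>c i k\<close> moves to the right, where the cocycle
  identity merges it with \<open>(\<sigma> ^^ i) (c (n - i) k)\<close> into \<open>c n k\<close>.
  This factor does not depend on i and leaves the sum.\<close>

lemma H_conv:
  assumes \<tau>: "\<tau> \<in> carrier AutD" and comm: "\<And>a. a \<in> carrier D \<Longrightarrow> \<tau> (\<sigma> a) = \<sigma> (\<tau> a)"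
    and k: "k \<in> center D" and gh: "g \<in> polys_below D m" "h \<in> polys_below D m"
  shows "conv (H \<tau> k g) (H \<tau> k h) n = \<tau> (conv g h n) \<otimes> c n k"
proof -
  interpret \<tau>: ring_hom_ring D D \<tau>
    using \<tau> by (intro ring_hom_ringI2 ring_axioms) (auto simp: algebra_autos_def ring_iso_def ring_hom_def)
  have comm_pow: "\<tau> ((\<sigma> ^^ i) a) = (\<sigma> ^^ i) (\<tau> a)" if "a \<in> carrier D" for a i
    using that by (induction i) (simp_all add: comm)
  have "H \<tau> k g i \<otimes> (\<sigma> ^^ i) (H \<tau> k h (n - i))
      = \<tau> (g i \<otimes> (\<sigma> ^^ i) (h (n - i))) \<otimes> c n k" if i: "i \<le> n" for i
  proof -
    let ?x = "\<tau> (g i)" and ?y = "(\<sigma> ^^ i) (\<tau> (h (n - i)))"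
    have "H \<tau> k g i \<otimes> (\<sigma> ^^ i) (H \<tau> k h (n - i)) = ?x \<otimes> (c i k \<otimes> ?y) \<otimes> (\<sigma> ^^ i) (c (n - i) k)"
      using gh k by (simp add: H_nth sigma_pow_mult m_assoc)
    also have "\<dots> = ?x \<otimes> ?y \<otimes> (c i k \<otimes> (\<sigma> ^^ i) (c (n - i) k))"
      using gh k center_comm[of "c i k" D ?y] by (simp add: m_assoc)
    also have "c i k \<otimes> (\<sigma> ^^ i) (c (n - i) k) = c n k"
      using orbit_prod_add[OF k, of i "n - i"] i by simp
    finally show ?thesis
      using gh by (simp add: comm_pow)
  qed
  then have "conv (H \<tau> k g) (H \<tau> k h) n
      = (\<Oplus>i\<in>{..n}. \<tau> (g i \<otimes> (\<sigma> ^^ i) (h (n - i))) \<otimes> c n k)"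
    unfolding conv_def using gh k by (intro finsum_cong') auto
  also have "\<dots> = (\<Oplus>i\<in>{..n}. \<tau> (g i \<otimes> (\<sigma> ^^ i) (h (n - i)))) \<otimes> c n k"
    using gh k by (intro finsum_ldistr[symmetric]) auto
  also have "(\<Oplus>i\<in>{..n}. \<tau> (g i \<otimes> (\<sigma> ^^ i) (h (n - i)))) = \<tau> (conv g h n)"
    unfolding conv_def using gh by (subst \<tau>.hom_finsum) (auto simp: comp_def)
  finally show ?thesis .
qed

text \<open>\<open>H_conv\<close> settles products before reduction, and the condition
  \<open>\<tau>d\<close> makes the map compatible with replacing t^m by d. Bijectivity holds since
  \<open>\<tau>\<close> is bijective and every orbit product of the unit \<open>k\<close> is a
  unit.\<close>

lemma H_auto:
  assumes \<tau>: "\<tau> \<in> carrier AutD" and comm: "\<And>a. a \<in> carrier D \<Longrightarrow> \<tau> (\<sigma> a) = \<sigma> (\<tau> a)"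
    and k: "k \<in> Units (center_ring D)" and \<tau>d: "\<tau> d = c m k \<otimes> d"
  shows "H \<tau> k \<in> carrier AutA"
proof -
  interpret \<tau>: ring_hom_ring D D \<tau>
    using \<tau> by (intro ring_hom_ringI2 ring_axioms) (auto simp: algebra_autos_def ring_iso_def ring_hom_def)
  have \<tau>_bij: "bij_betw \<tau> (carrier D) (carrier D)"
    using \<tau> by (simp add: algebra_autos_def ring_iso_def)
  have kc: "k \<in> center D"
    using k by (simp add: Units_center_ring)
  have cu: "c i k \<in> Units D" for i
    using orbit_prod_unit[OF k] by (simp add: Units_center_ring)
  have comm_pow: "\<tau> ((\<sigma> ^^ i) a) = (\<sigma> ^^ i) (\<tau> a)" if "a \<in> carrier D" for a i
    using that by (induction i) (simp_all add: comm)
  have "inj_on (H \<tau> k) (polys_below D m)"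
  proof (rule inj_onI)
    fix a b assume ab: "a \<in> polys_below D m" "b \<in> polys_below D m" "H \<tau> k a = H \<tau> k b"
    have "a i = b i" for i
    proof -
      have "\<tau> (a i) \<otimes> c i k = \<tau> (b i) \<otimes> c i k"
        using ab(3) by (metis ab(1,2) H_nth)
      then have "\<tau> (a i) = \<tau> (b i)"
        using ab kc center_comm[of "c i k" D "\<tau> (a i)"] center_comm[of "c i k" D "\<tau> (b i)"]
          Units_l_cancel[OF cu[of i], of "\<tau> (a i)" "\<tau> (b i)"] by simp
      then show ?thesis
        by (rule inj_onD[OF bij_betw_imp_inj_on[OF \<tau>_bij]]) (use ab in simp_all)
    qed
    then show "a = b"
      by (simp add: fun_eq_iff)
  qed
  moreover have "b \<in> H \<tau> k ` polys_below D m" if b: "b \<in> polys_below D m" for b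
  proof -
    let ?a = "\<lambda>i. inv_into (carrier D) \<tau> (b i \<otimes> inv (c i k))"
    have img: "x \<in> \<tau> ` carrier D" if "x \<in> carrier D" for x
      using \<tau>_bij that by (simp add: bij_betw_def)
    have a: "?a i \<in> carrier D" "\<tau> (?a i) = b i \<otimes> inv (c i k)" for i
      using b cu by (auto intro!: inv_into_into f_inv_into_f img)
    \<comment> \<open>Ensures that the candidate preimage again has no coefficients from index m
      on.\<close>
    have "inv_into (carrier D) \<tau> \<zero> = \<zero>"
      using \<tau>_bij inv_into_f_f[of \<tau> "carrier D" \<zero>] by (simp add: bij_betw_def)
    then have "?a \<in> polys_below D m"
      using a cu b by (simp add: polys_below_iff)
    moreover have "H \<tau> k ?a = b"
      using a cu b \<open>?a \<in> _\<close> by (auto simp: H_nth fun_eq_iff m_assoc Units_closed)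
    ultimately show ?thesis
      by (intro image_eqI[of _ _ ?a]) auto
  qed
  ultimately have Bij: "H \<tau> k \<in> Bij (polys_below D m)"
    using H_below[OF \<tau> kc] by (auto simp: Bij_def bij_betw_def H_map_def)
  have mult: "H \<tau> k (g \<otimes>\<^bsub>A\<^esub> h) = H \<tau> k g \<otimes>\<^bsub>A\<^esub> H \<tau> k h"
    if gh: "g \<in> polys_below D m" "h \<in> polys_below D m" for g h
  proof (rule ext)
    fix n
    \<comment> \<open>The cocycle identity splits off \<open>c m k\<close> inside
      \<open>\<sigma> ^^ n\<close>, where \<open>\<tau>d\<close> turns
      \<open>c m k \<otimes> d\<close> into \<open>\<tau> d\<close>.\<close>
    have shift: "c (n + m) k \<otimes> (\<sigma> ^^ n) d = \<tau> ((\<sigma> ^^ n) d) \<otimes> c n k"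
    proof -
      have "c (n + m) k \<otimes> (\<sigma> ^^ n) d = c n k \<otimes> (\<sigma> ^^ n) (c m k \<otimes> d)"
        using kc by (simp add: orbit_prod_add sigma_pow_mult m_assoc)
      also have "\<dots> = c n k \<otimes> \<tau> ((\<sigma> ^^ n) d)"
        by (simp add: comm_pow \<tau>d)
      finally show ?thesis
        using kc center_comm[of "c n k" D "\<tau> ((\<sigma> ^^ n) d)"] by simp
    qed
    show "H \<tau> k (g \<otimes>\<^bsub>A\<^esub> h) n = (H \<tau> k g \<otimes>\<^bsub>A\<^esub> H \<tau> k h) n"
    proof (cases "n < m")
      case True
      then have "(H \<tau> k g \<otimes>\<^bsub>A\<^esub> H \<tau> k h) n
          = \<tau> (conv g h n) \<otimes> c n k \<oplus> \<tau> (conv g h (n + m)) \<otimes> (c (n + m) k \<otimes> (\<sigma> ^^ n) d)"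
        using gh kc H_below[OF \<tau> kc]
        by (simp add: gen_cyclic_mult H_conv[OF \<tau> comm kc] m_assoc)
      also have "\<dots> = \<tau> (conv g h n \<oplus> conv g h (n + m) \<otimes> (\<sigma> ^^ n) d) \<otimes> c n k"
        using gh kc by (simp add: shift l_distr m_assoc)
      also have "\<dots> = H \<tau> k (g \<otimes>\<^bsub>A\<^esub> h) n"
        using True gh by (simp add: H_nth gen_cyclic_mult_closed) (simp add: gen_cyclic_mult)
      finally show ?thesis ..
    next
      case False
      then show ?thesis
        using gh H_below[OF \<tau> kc] gen_cyclic_mult_closed by (simp add: polys_below_zero)
    qed
  qed
  have add: "H \<tau> k (\<lambda>i. g i \<oplus> h i) = (\<lambda>i. H \<tau> k g i \<oplus> H \<tau> k h i)"
    if gh: "g \<in> polys_below D m" "h \<in> polys_below D m" for g h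
  proof -
    have "(\<lambda>i. g i \<oplus> h i) \<in> polys_below D m"
      using gh by (simp add: polys_below_iff)
    then show ?thesis
      using gh kc by (simp add: H_nth fun_eq_iff l_distr)
  qed
  have smult: "H \<tau> k (\<lambda>i. s \<otimes> g i) = (\<lambda>i. s \<otimes> H \<tau> k g i)"
    if s: "s \<in> carrier S0" and g: "g \<in> polys_below D m" for s g
  proof -
    have "(\<lambda>i. s \<otimes> g i) \<in> polys_below D m"
      using s g by (simp add: polys_below_iff)
    moreover have "\<tau> (s \<otimes> x) = s \<otimes> \<tau> x" if "x \<in> carrier D" for x
      using \<tau> s that by (simp add: mem_algebra_autos_iff)
    ultimately show ?thesis
      using s g kc by (simp add: H_nth fun_eq_iff m_assoc)
  qed
  have one: "H \<tau> k (skew_monom D \<one> 0) = skew_monom D \<one> 0"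
    using m_ge_2 kc by (simp add: H_nth fun_eq_iff) (simp add: skew_monom_def)
  show ?thesis
    unfolding algebra_auto_group_simps mem_algebra_autos_iff
    using Bij mult add one smult by simp
qed

text \<open>Since \<open>\<tau>\<close> fixes the orbit products of \<open>k'\<close>, the two
  scalar factors combine to \<open>c i (k \<otimes> k')\<close>. The condition is met both for
  \<open>\<tau> = idD\<close> and for \<open>k'\<close> in \<open>S0\<close>.\<close>

lemma H_compose:
  assumes \<tau>: "\<tau> \<in> carrier AutD" "\<tau>' \<in> carrier AutD" and k: "k \<in> center D" "k' \<in> center D"
    and fixes_orbit: "\<And>i. \<tau> (c i k') = c i k'"
  shows "compose (carrier A) (H \<tau> k) (H \<tau>' k') = H (compose (carrier D) \<tau> \<tau>') (k \<otimes> k')"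
proof (rule extensionalityI[of _ "polys_below D m"])
  fix a assume a: "a \<in> polys_below D m"
  have closed: "\<tau> x \<in> carrier D" "\<tau>' x \<in> carrier D" if "x \<in> carrier D" for x
    using \<tau> that by (auto simp: algebra_autos_def ring_iso_def ring_hom_def)
  have "\<tau> (\<tau>' (a i) \<otimes> c i k') \<otimes> c i k = \<tau> (\<tau>' (a i)) \<otimes> c i (k \<otimes> k')" for i
  proof -
    have "\<tau> (\<tau>' (a i) \<otimes> c i k') = \<tau> (\<tau>' (a i)) \<otimes> c i k'"
      using \<tau> a k closed by (simp add: mem_algebra_autos_iff fixes_orbit)
    moreover have "c i k' \<otimes> c i k = c i k \<otimes> c i k'"
      using k center_comm[of "c i k" D "c i k'"] by simp
    ultimately show ?thesis
      using a k closed by (simp add: m_assoc orbit_prod_mult)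
  qed
  then show "compose (carrier A) (H \<tau> k) (H \<tau>' k') a = H (compose (carrier D) \<tau> \<tau>') (k \<otimes> k') a"
    using a H_below[OF \<tau>(2) k(2) a] by (simp add: fun_eq_iff compose_eq H_nth)
qed (simp_all add: H_map_def compose_def)

end

section \<open>Automorphisms over \<open>D\<close> and cyclic subgroups\<close>

context skew_cyclic
begin

abbreviation E where "E \<equiv> autos_extending_id D \<sigma> m d"

abbreviation K where "K \<equiv> norm_one_units D \<sigma> m"

lemma norm_one_units_center: "k \<in> K \<Longrightarrow> k \<in> center D"
  by (simp add: norm_one_units_def Units_center_ring)

text \<open>For \<open>\<tau> = idD\<close> the condition on \<open>d\<close> in
  \<open>H_auto\<close> follows from norm 1, and constants are fixed because
  \<open>c 0 k = \<one>\<close>.\<close>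

lemma H_idD_extends: "k \<in> K \<Longrightarrow> H idD k \<in> E"
proof -
  assume k: "k \<in> K"
  have "H idD k \<in> carrier AutA"
    by (rule H_auto) (use k idD_auto in \<open>simp_all add: norm_one_units_def\<close>)
  moreover have "H idD k (skew_monom D a 0) = skew_monom D a 0" if "a \<in> carrier D" for a
    using that m_ge_2 norm_one_units_center[OF k] by (auto simp: fun_eq_iff H_nth) (simp_all add: skew_monom_def)
  ultimately show ?thesis
    by (simp add: autos_extending_id_def)
qed

lemma extends_id_imp_H:
  assumes galois: "cyclic_galois_extension S0 (center_ring D) \<sigma> m"
    and F: "F \<in> E"
  shows "\<exists>k\<in>K. F = H idD k"
proof -
  have Bij: "F \<in> Bij (polys_below D m)"
    and F_mult: "\<And>g h. g \<in> polys_below D m \<Longrightarrow> h \<in> polys_below D m \<Longrightarrow> F (g \<otimes>\<^bsub>A\<^esub> h) = F g \<otimes>\<^bsub>A\<^esub> F h"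
    and F_add: "\<And>g h. g \<in> polys_below D m \<Longrightarrow> h \<in> polys_below D m \<Longrightarrow> F (\<lambda>i. g i \<oplus> h i) = (\<lambda>i. F g i \<oplus> F h i)"
    and F_const: "\<And>a. a \<in> carrier D \<Longrightarrow> F (skew_monom D a 0) = skew_monom D a 0"
    using F by (auto simp: autos_extending_id_def mem_algebra_autos_iff)
  have F_below [simp]: "F g \<in> polys_below D m" if "g \<in> polys_below D m" for g
    using Bij_imp_funcset[OF Bij] that by auto
  have m: "0 < m" "1 < m"
    using m_ge_2 by simp_all
  let ?t = "skew_monom D \<one> 1"
  have t: "?t \<in> polys_below D m"
    using m by simp
  define k where "k = F ?t 1"
  have k_closed [simp]: "k \<in> carrier D"
    using t by (simp add: k_def)
  \<comment> \<open>Coefficient n of F(t) a = \<sigma>(a) F(t), which is the image of t a =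
    \<sigma>(a) t.\<close>
  have comm: "F ?t n \<otimes> (\<sigma> ^^ n) a = \<sigma> a \<otimes> F ?t n" if a: "a \<in> carrier D" for a n
  proof -
    have "?t \<otimes>\<^bsub>A\<^esub> skew_monom D a 0 = skew_monom D (\<sigma> a) 0 \<otimes>\<^bsub>A\<^esub> ?t"
      using a m by (simp add: mult_monom_monom)
    then have "F ?t \<otimes>\<^bsub>A\<^esub> skew_monom D a 0 = skew_monom D (\<sigma> a) 0 \<otimes>\<^bsub>A\<^esub> F ?t"
      using a m t F_mult[of ?t "skew_monom D a 0"] F_mult[of "skew_monom D (\<sigma> a) 0" ?t] by (simp add: F_const)
    then show ?thesis
      using a t by (simp add: mult_const_right mult_const_left fun_eq_iff)
  qed
  have vanish: "F ?t n = \<zero>" if "n < m" "n \<noteq> 1" for n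
  proof (rule galois_intertwiner_zero[OF galois _ that])
    show "F ?t n \<in> carrier D"
      using t by simp
    fix y assume y: "y \<in> center D"
    \<comment> \<open>Centrality of \<open>\<sigma> y\<close> moves it to the right of the
      coefficient, as the vanishing criterion demands.\<close>
    then have "\<sigma> y \<in> center D"
      using sigma_pow_center[OF y, of 1] by simp
    then show "F ?t n \<otimes> (\<sigma> ^^ n) y = F ?t n \<otimes> \<sigma> y"
      using comm[of y n] y t center_comm[of "\<sigma> y" D "F ?t n"] by (simp add: center_closed)
  qed
  have Ft: "F ?t = skew_monom D k 1"
  proof
    show "F ?t n = skew_monom D k 1 n" for n
      using vanish[of n] polys_below_zero[OF F_below[OF t], of n]
      by (cases "n < m") (use m in \<open>auto simp: skew_monom_def k_def\<close>)
  qed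
  \<comment> \<open>The relation \<open>comm\<close> at n = 1 says that \<open>k\<close> commutes
    with every \<open>\<sigma> a\<close>, and these values exhaust \<open>D\<close>.\<close>
  have k_center: "k \<in> center D"
  proof (rule centerI)
    fix b assume "b \<in> carrier D"
    moreover have "\<sigma> ` carrier D = carrier D"
      using sigma_pow_bij[of 1] by (simp add: bij_betw_def)
    ultimately obtain a where "a \<in> carrier D" "b = \<sigma> a"
      by blast
    then show "k \<otimes> b = b \<otimes> k"
      using comm[of a 1] by (simp add: k_def)
  qed simp
  \<comment> \<open>Each power is formed as t times the previous one, which avoids associativity; i
    < m keeps the product free of reduction.\<close>
  have F_power: "F (skew_monom D \<one> i) = skew_monom D (c i k) i" if "i < m" for i
    using that
  proof (induction i)
    case 0
    then show ?case
      by (simp add: F_const)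
  next
    case (Suc i)
    have "?t \<otimes>\<^bsub>A\<^esub> skew_monom D \<one> i = skew_monom D \<one> (Suc i)"
      using Suc.prems m by (simp add: mult_monom_monom)
    then have "F (skew_monom D \<one> (Suc i)) = skew_monom D k 1 \<otimes>\<^bsub>A\<^esub> skew_monom D (c i k) i"
      using Suc F_mult[OF t, of "skew_monom D \<one> i"] by (simp add: Ft[simplified])
    also have "\<dots> = skew_monom D (c (Suc i) k) (Suc i)"
      using Suc.prems m k_center orbit_prod_add[OF k_center, of 1 i]
      by (simp add: mult_monom_monom orbit_prod_1)
    finally show ?case .
  qed
  have F_monom: "F (skew_monom D a i) = skew_monom D (a \<otimes> c i k) i" if "a \<in> carrier D" "i < m" for a i
  proof -
    have "skew_monom D a 0 \<otimes>\<^bsub>A\<^esub> skew_monom D \<one> i = skew_monom D a i"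
      using that m by (simp add: mult_monom_monom)
    then have "F (skew_monom D a i) = skew_monom D a 0 \<otimes>\<^bsub>A\<^esub> skew_monom D (c i k) i"
      using that m F_mult[of "skew_monom D a 0" "skew_monom D \<one> i"] by (simp add: F_const F_power)
    then show ?thesis
      using that m k_center by (simp add: mult_monom_monom)
  qed
  have F_coeff: "F g = (\<lambda>i. g i \<otimes> c i k)" if "g \<in> polys_below D m" for g
  proof -
    \<comment> \<open>Induction on a degree bound: the top monomial is split off by setting
      coefficient n to 0, and additivity of \<open>F\<close> reassembles the values.\<close>
    have "F g = (\<lambda>i. g i \<otimes> c i k)" if "g \<in> polys_below D m" "n \<le> m" "\<And>i. i \<ge> n \<Longrightarrow> g i = \<zero>" for g n
      using that
    proof (induction n arbitrary: g)
      case 0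
      then have "g = skew_monom D \<zero> 0"
        by (auto simp: skew_monom_def)
      then show ?case
        using F_const[of \<zero>] k_center by (auto simp: skew_monom_def)
    next
      case (Suc n)
      let ?h = "g(n := \<zero>)"
      have h: "?h \<in> polys_below D m"
        using Suc.prems by (simp add: polys_below_iff)
      have IH: "F ?h = (\<lambda>i. ?h i \<otimes> c i k)"
        by (rule Suc.IH[OF h]) (use Suc.prems in \<open>simp_all add: not_less_eq_eq\<close>)
      have gn: "g n \<in> carrier D" "n < m"
        using Suc.prems by simp_all
      have "g = (\<lambda>i. ?h i \<oplus> skew_monom D (g n) n i)"
        using Suc.prems(1) by (auto simp: fun_eq_iff skew_monom_def)
      then have "F g = F (\<lambda>i. ?h i \<oplus> skew_monom D (g n) n i)"
        by simp
      also have "\<dots> = (\<lambda>i. F ?h i \<oplus> F (skew_monom D (g n) n) i)"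
        by (rule F_add[OF h]) (simp add: gn)
      also have "\<dots> = (\<lambda>i. g i \<otimes> c i k)"
        unfolding IH F_monom[OF gn] using Suc.prems(1) k_center
        by (auto simp: fun_eq_iff skew_monom_def)
      finally show ?case .
    qed
    from this[of g m] show ?thesis
      using that by (simp add: polys_below_zero)
  qed
  have "k \<in> Units (center_ring D)"
  proof -
    \<comment> \<open>The coefficient at 1 of a preimage of t is the inverse of
      \<open>k\<close>.\<close>
    have "?t \<in> F ` polys_below D m"
      using Bij t by (simp add: Bij_def bij_betw_def)
    then obtain g where g: "g \<in> polys_below D m" "F g = ?t"
      by (metis imageE)
    have "g 1 \<otimes> k = \<one>"
      using fun_cong[OF g(2), of 1] F_coeff[OF g(1)] k_center
      by (simp add: orbit_prod_1 skew_monom_def)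
    moreover have "k \<otimes> g 1 = g 1 \<otimes> k"
      using g by (intro center_comm[OF k_center]) simp
    ultimately have "k \<in> Units D"
      using g by (auto simp: Units_def intro!: bexI[of _ "g 1"])
    then show ?thesis
      using k_center by (simp add: Units_center_ring)
  qed
  moreover have "c m k = \<one>"
  proof -
    \<comment> \<open>The product of t and t^(m-1) reaches degree m and reduces to the constant d,
      which \<open>F\<close> fixes. Comparing images yields N(k) d = d, and the unit d
      cancels.\<close>
    let ?u = "skew_monom D \<one> (m - 1)"
    have "?t \<otimes>\<^bsub>A\<^esub> ?u = skew_monom D d 0"
      using m by (simp add: mult_monom_monom)
    then have "skew_monom D k 1 \<otimes>\<^bsub>A\<^esub> skew_monom D (c (m - 1) k) (m - 1) = skew_monom D d 0"
      using m F_mult[OF t, of ?u] by (simp add: Ft[simplified] F_power F_const)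
    then have "skew_monom D (c m k \<otimes> d) 0 = skew_monom D d 0"
      using m k_center orbit_prod_add[OF k_center, of 1 "m - 1"]
      by (simp add: mult_monom_monom orbit_prod_1)
    then have "c m k \<otimes> d = d"
      by (auto simp: skew_monom_def dest: fun_cong[of _ _ 0])
    then have "c m k \<otimes> d \<otimes> inv d = d \<otimes> inv d"
      by simp
    then show ?thesis
      using d_unit k_center by (simp add: m_assoc)
  qed
  moreover have "F = H idD k"
  proof (rule extensionalityI[of _ "polys_below D m"])
    show "F \<in> extensional (polys_below D m)"
      using Bij by (simp add: Bij_def)
    show "F g = H idD k g" if "g \<in> polys_below D m" for g
      using F_coeff[OF that] that by (simp add: fun_eq_iff H_nth)
  qed (simp add: H_map_def)
  ultimately show ?thesis
    by (auto simp: norm_one_units_def)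
qed

section \<open>The isomorphism with the units of norm 1\<close>

lemma subgroup_norm_one_units: "subgroup K (units_of (center_ring D))"
proof -
  interpret C: cring "center_ring D" by (rule cring_center_ring)
  interpret U: comm_group "units_of (center_ring D)" by (rule C.units_comm_group)
  show ?thesis
  proof (rule U.subgroupI)
    show "K \<subseteq> carrier (units_of (center_ring D))"
      by (auto simp: norm_one_units_def units_of_carrier)
    show "K \<noteq> {}"
      using C.Units_one_closed by (auto simp: norm_one_units_def intro!: exI[of _ \<one>])
    fix k assume k: "k \<in> K"
    let ?k' = "inv\<^bsub>center_ring D\<^esub> k"
    have u: "k \<in> Units (center_ring D)" and "c m k = \<one>"
      using k by (simp_all add: norm_one_units_def)
    moreover have k': "?k' \<in> center D"
      using C.Units_inv_closed[OF u] by simp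
    moreover have "k \<otimes> ?k' = \<one>"
      using C.Units_r_inv[OF u] by simp
    ultimately have "c m ?k' = \<one>"
      using orbit_prod_mult[of k ?k' m] norm_one_units_center[OF k] by simp
    then show "inv\<^bsub>units_of (center_ring D)\<^esub> k \<in> K"
      using u by (simp add: C.units_of_inv norm_one_units_def)
    fix l assume l: "l \<in> K"
    then show "k \<otimes>\<^bsub>units_of (center_ring D)\<^esub> l \<in> K"
      using k norm_one_units_center[OF k] norm_one_units_center[OF l] C.Units_m_closed[of k l]
      by (simp add: units_of_mult norm_one_units_def orbit_prod_mult)
  qed
qed

lemma H_idD_hom: "(\<lambda>k. H idD k) \<in> hom (units_of (center_ring D)\<lparr>carrier := K\<rparr>) AutA"
proof (rule homI)
  fix k l assume "k \<in> carrier (units_of (center_ring D)\<lparr>carrier := K\<rparr>)"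
    and "l \<in> carrier (units_of (center_ring D)\<lparr>carrier := K\<rparr>)"
  then have k: "k \<in> K" "k \<in> center D" and l: "l \<in> K" "l \<in> center D"
    by (simp_all add: norm_one_units_center)
  have "H idD k \<otimes>\<^bsub>AutA\<^esub> H idD l = compose (carrier A) (H idD k) (H idD l)"
    using H_idD_extends[OF k(1)] H_idD_extends[OF l(1)]
    by (intro algebra_auto_group_mult) (simp_all add: autos_extending_id_def)
  also have "\<dots> = H (compose (carrier D) idD idD) (k \<otimes> l)"
    using idD_auto k l by (intro H_compose) simp_all
  finally show "H idD (k \<otimes>\<^bsub>units_of (center_ring D)\<lparr>carrier := K\<rparr>\<^esub> l) = H idD k \<otimes>\<^bsub>AutA\<^esub> H idD l"
    by (simp add: units_of_mult)
qed (use H_idD_extends in \<open>simp add: autos_extending_id_def\<close>)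

text \<open>The map sending \<open>k\<close> to \<open>H idD k\<close> is a homomorphism on
  \<open>K\<close> with image exactly \<open>E\<close>, so \<open>E\<close> is a subgroup as an
  image. The Galois condition enters through surjectivity.\<close>

lemma autos_extending_id_iso:
  assumes "cyclic_galois_extension S0 (center_ring D) \<sigma> m"
  shows "subgroup E AutA" "AutA\<lparr>carrier := E\<rparr> \<cong> units_of (center_ring D)\<lparr>carrier := K\<rparr>"
proof -
  interpret C: cring "center_ring D" by (rule cring_center_ring)
  let ?K = "units_of (center_ring D)\<lparr>carrier := K\<rparr>"
  interpret K: group ?K
    using C.units_group subgroup_norm_one_units by (rule group.subgroup_imp_group)
  interpret h: group_hom ?K AutA "\<lambda>k. H idD k"
    using H_idD_hom by unfold_locales
  have img: "(\<lambda>k. H idD k) ` K = E"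
    using extends_id_imp_H[OF assms] H_idD_extends by blast
  then show sub: "subgroup E AutA"
    using h.img_is_subgroup by simp
  have "inj_on (\<lambda>k. H idD k) K"
  proof (rule inj_onI)
    fix k l assume kl: "k \<in> K" "l \<in> K" "H idD k = H idD l"
    \<comment> \<open>Injectivity: \<open>k'\<close> is recovered as the coefficient at 1 of the
      image of t.\<close>
    have "H idD k' (skew_monom D \<one> 1) 1 = k'" if "k' \<in> K" for k'
      using norm_one_units_center[OF that] m_ge_2
      by (simp add: H_nth orbit_prod_1 center_closed) (simp add: skew_monom_def center_closed)
    then show "k = l"
      using kl by metis
  qed
  then have "(\<lambda>k. H idD k) \<in> iso ?K (AutA\<lparr>carrier := E\<rparr>)"
    using H_idD_hom img by (auto simp: iso_def hom_def bij_betw_def)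
  then show "AutA\<lparr>carrier := E\<rparr> \<cong> ?K"
    by (intro K.iso_sym) (auto simp: is_iso_def)
qed

section \<open>Powers and order of \<open>H \<tau> \<omega>\<close>\<close>

lemma H_power:
  assumes \<omega>: "\<omega> \<in> carrier S0" and \<tau>: "\<tau> \<in> carrier AutD" and H: "H \<tau> \<omega> \<in> carrier AutA"
  shows "H \<tau> \<omega> [^]\<^bsub>AutA\<^esub> (n::nat) = H (\<tau> [^]\<^bsub>AutD\<^esub> n) (\<omega> [^] n)"
proof (induction n)
  case 0
  have "(\<lambda>a\<in>polys_below D m. a) = H idD \<one>"
    by (auto simp: fun_eq_iff H_map_def)
  then show ?case
    by (simp only: nat_pow_0 AutA.nat_pow_0 AutD.nat_pow_0 algebra_auto_group_simps
        self_algebra_simps gen_cyclic_simps)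
next
  case (Suc n)
  have \<omega>c: "\<omega> \<in> center D" and \<omega>n: "\<omega> [^] i \<in> center D" for i :: nat
    using \<omega> by (auto simp flip: orbit_prod_fixed[OF \<omega>])
  let ?\<tau>n = "\<tau> [^]\<^bsub>AutD\<^esub> n"
  have \<tau>n: "?\<tau>n \<in> carrier AutD"
    using \<tau> by (rule AutD.nat_pow_closed)
  \<comment> \<open>An \<open>S0\<close>-linear map that preserves \<open>\<one>\<close> fixes s = s
    1, hence all powers of \<open>\<omega>\<close>; this supplies the premise of
    \<open>H_compose\<close>.\<close>
  have "?\<tau>n s = s" if "s \<in> carrier S0" for s
  proof -
    have linear: "\<forall>r\<in>carrier S0. \<forall>x\<in>carrier D. ?\<tau>n (r \<otimes> x) = r \<otimes> ?\<tau>n x" and "?\<tau>n \<one> = \<one>"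
      using \<tau>n unfolding algebra_auto_group_simps mem_algebra_autos_iff self_algebra_simps by blast+
    then show ?thesis
      using bspec[OF bspec[OF linear that] one_closed] that by simp
  qed
  moreover have "\<sigma> (\<omega> [^] i) = \<omega> [^] i" for i :: nat
    using \<omega> ring_iso_memE(2,4)[OF sigma] by (induction i) simp_all
  ultimately have fixed: "?\<tau>n (c i \<omega>) = c i \<omega>" for i
    using \<omega>n \<omega> by (simp add: orbit_prod_fixed[OF \<omega>])
  have "H \<tau> \<omega> [^]\<^bsub>AutA\<^esub> Suc n = compose (carrier A) (H ?\<tau>n (\<omega> [^] n)) (H \<tau> \<omega>)"
    using Suc H AutA.nat_pow_closed[OF H, of n] by (simp add: algebra_auto_group_mult)
  also have "\<dots> = H (compose (carrier D) ?\<tau>n \<tau>) (\<omega> [^] n \<otimes> \<omega>)"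
    by (rule H_compose[OF \<tau>n \<tau> \<omega>n \<omega>c fixed])
  also have "\<dots> = H (\<tau> [^]\<^bsub>AutD\<^esub> Suc n) (\<omega> [^] Suc n)"
    using \<tau>n \<tau> by (simp add: algebra_auto_group_mult)
  finally show ?case .
qed

text \<open>The power with exponent ms is \<open>H\<close> of the identity and
  \<open>\<one>\<close>, which is the identity of the algebra, so the order divides ms. As ms is
  positive, the order is neither 0, which would encode infinite order, nor larger than ms.\<close>

lemma H_order_finite:
  assumes \<omega>: "\<omega> \<in> carrier S0" "\<omega> [^] m = \<one>" and \<tau>: "\<tau> \<in> carrier AutD"
    and H: "H \<tau> \<omega> \<in> carrier AutA" and s: "0 < s" "AutD.ord \<tau> = s"
  shows "finite (carrier (subgroup_generated AutA {H \<tau> \<omega>}))"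
    "order (subgroup_generated AutA {H \<tau> \<omega>}) \<le> m * s"
proof -
  have "\<tau> [^]\<^bsub>AutD\<^esub> (m * s) = \<one>\<^bsub>AutD\<^esub>"
    using AutD.pow_eq_id[OF \<tau>, of "m * s"] s by simp
  moreover have "\<omega> [^] (m * s) = \<one>"
    using \<omega> nat_pow_pow[of \<omega> m s] by simp
  ultimately have "H \<tau> \<omega> [^]\<^bsub>AutA\<^esub> (m * s) = H \<one>\<^bsub>AutD\<^esub> \<one>"
    by (simp add: H_power[OF \<omega>(1) \<tau> H])
  also have "\<dots> = H \<tau> \<omega> [^]\<^bsub>AutA\<^esub> (0::nat)"
    using H_power[OF \<omega>(1) \<tau> H, of 0] by simp
  finally have "AutA.ord (H \<tau> \<omega>) dvd m * s"
    by (simp add: AutA.pow_eq_id[OF H, symmetric])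
  moreover have ms: "0 < m * s"
    using m_ge_2 s by simp
  ultimately have ord: "AutA.ord (H \<tau> \<omega>) \<noteq> 0" "AutA.ord (H \<tau> \<omega>) \<le> m * s"
    using dvd_imp_le dvd_pos_nat by blast+
  show "finite (carrier (subgroup_generated AutA {H \<tau> \<omega>}))"
    using AutA.finite_cyclic_subgroup_order[OF H] ord by simp
  show "order (subgroup_generated AutA {H \<tau> \<omega>}) \<le> m * s"
    using AutA.cyclic_order_is_ord[OF H] ord by simp
qed

text \<open>On constants the n-th power of \<open>H \<tau> \<omega>\<close> acts as the n-th power
  of \<open>\<tau>\<close>, so a trivial positive power of the former would give
  \<open>\<tau>\<close> finite order.\<close>

lemma H_order_infinite:
  assumes \<omega>: "\<omega> \<in> carrier S0" and \<tau>: "\<tau> \<in> carrier AutD"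
    and H: "H \<tau> \<omega> \<in> carrier AutA" and ord: "AutD.ord \<tau> = 0"
  shows "infinite (carrier (subgroup_generated AutA {H \<tau> \<omega>}))"
proof -
  have "H \<tau> \<omega> [^]\<^bsub>AutA\<^esub> n \<noteq> \<one>\<^bsub>AutA\<^esub>" if "n \<noteq> 0" for n :: nat
  proof
    assume eq: "H \<tau> \<omega> [^]\<^bsub>AutA\<^esub> n = \<one>\<^bsub>AutA\<^esub>"
    let ?\<tau>n = "\<tau> [^]\<^bsub>AutD\<^esub> n"
    have \<tau>n: "?\<tau>n \<in> carrier AutD"
      using \<tau> by (rule AutD.nat_pow_closed)
    have "?\<tau>n = idD"
    proof (rule extensionalityI[of _ "carrier D"])
      show "?\<tau>n \<in> extensional (carrier D)"
        using \<tau>n by (simp add: algebra_autos_def)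
      fix a assume a: "a \<in> carrier D"
      then have a0: "skew_monom D a 0 \<in> polys_below D m"
        using m_ge_2 by simp
      have closed: "?\<tau>n a \<in> carrier D"
        using \<tau>n a by (auto simp: algebra_autos_def ring_iso_def ring_hom_def)
      have "H ?\<tau>n (\<omega> [^] n) (skew_monom D a 0) 0 = skew_monom D a 0 0"
        using eq a0 by (simp flip: H_power[OF \<omega> \<tau> H])
      then show "?\<tau>n a = idD a"
        using a closed by (simp add: H_nth[OF a0]) (simp add: skew_monom_def)
    qed simp
    then show False
      using AutD.ord_eq_0[OF \<tau>] ord that by simp
  qed
  then have "AutA.ord (H \<tau> \<omega>) = 0"
    using AutA.ord_eq_0[OF H] by simp
  then show ?thesis
    using AutA.infinite_cyclic_subgroup_order[OF H] by simp
qed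

text \<open>The inverse of \<open>\<omega>\<close> is its power with exponent m - 1.\<close>

lemma root_of_unity_unit:
  assumes "\<omega> \<in> carrier S0" "\<omega> [^] m = \<one>"
  shows "\<omega> \<in> Units (center_ring D)"
proof -
  have "\<omega> [^] (m - 1) \<otimes> \<omega> = \<one>"
    using assms m_ge_2 nat_pow_Suc[of \<omega> "m - 1"] by simp
  moreover have "\<omega> \<otimes> \<omega> [^] (m - 1) = \<one>"
    using assms m_ge_2 nat_pow_Suc2[of \<omega> "m - 1"] by simp
  ultimately have "\<omega> \<in> Units D"
    using assms by (auto simp: Units_def intro!: bexI[of _ "\<omega> [^] (m - 1)"])
  then show ?thesis
    using assms by (simp add: Units_center_ring)
qed

end

theorem corollary11:
  fixes D :: "('a, 'b) ring_scheme" and \<sigma> :: "'a \<Rightarrow> 'a" and m :: nat and d :: 'a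
  assumes "azumaya D"
    and "\<exists>n. has_constant_rank (center_ring D) (self_algebra D) n"
    and "\<sigma> \<in> ring_iso D D"
    and "m \<ge> 2"
    and "cyclic_galois_extension (fixed_center_ring D \<sigma>) (center_ring D) \<sigma> m"
    and "d \<in> Units D"
  shows "let S0 = fixed_center_ring D \<sigma>;
             C = center_ring D;
             AutD = algebra_auto_group S0 (self_algebra D);
             AutA = algebra_auto_group S0 (gen_cyclic_algebra D \<sigma> m d);
             E = autos_extending_id D \<sigma> m d;
             K = norm_one_units D \<sigma> m;
             N = orbit_prod D \<sigma> m;
             H = H_map D \<sigma> m
         in
         (subgroup E AutA \<and> subgroup K (units_of C) \<and>
          AutA\<lparr>carrier := E\<rparr> \<cong> (units_of C)\<lparr>carrier := K\<rparr>)
         \<and>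
         (\<forall>\<omega>\<in>carrier S0. \<omega> [^]\<^bsub>D\<^esub> m = \<one>\<^bsub>D\<^esub> \<longrightarrow>
            (\<forall>\<tau>\<in>carrier AutD.
               (\<forall>a\<in>carrier D. \<tau> (\<sigma> a) = \<sigma> (\<tau> a)) \<and>
               \<tau> d = N \<omega> \<otimes>\<^bsub>D\<^esub> d \<and> N \<omega> \<otimes>\<^bsub>D\<^esub> d = d \<longrightarrow>
                 H \<tau> \<omega> \<in> carrier AutA \<and>
                 (\<forall>s. 0 < s \<and> group.ord AutD \<tau> = s \<longrightarrow>
                    finite (carrier (subgroup_generated AutA {H \<tau> \<omega>})) \<and>
                    order (subgroup_generated AutA {H \<tau> \<omega>}) \<le> m * s) \<and>
                 (group.ord AutD \<tau> = 0 \<longrightarrow>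
                    infinite (carrier (subgroup_generated AutA {H \<tau> \<omega>})))) \<and>
            (let h = H (\<lambda>x\<in>carrier D. x) \<omega>
             in h \<in> carrier AutA \<and>
                subgroup (carrier (subgroup_generated AutA {h})) AutA \<and>
                cyclic_group (subgroup_generated AutA {h}) \<and>
                finite (carrier (subgroup_generated AutA {h})) \<and>
                order (subgroup_generated AutA {h}) \<le> m))"
proof -
  interpret skew_cyclic D \<sigma> m d
    using assms by (simp add: azumaya_def skew_cyclic_def skew_cyclic_axioms_def)
  have "H idD \<omega> \<in> carrier AutA \<and>
      subgroup (carrier (subgroup_generated AutA {H idD \<omega>})) AutA \<and>
      cyclic_group (subgroup_generated AutA {H idD \<omega>}) \<and>
      finite (carrier (subgroup_generated AutA {H idD \<omega>})) \<and>
      order (subgroup_generated AutA {H idD \<omega>}) \<le> m"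
    if \<omega>: "\<omega> \<in> carrier S0" "\<omega> [^]\<^bsub>D\<^esub> m = \<one>\<^bsub>D\<^esub>" for \<omega>
  proof -
    have H: "H idD \<omega> \<in> carrier AutA"
      using idD_auto root_of_unity_unit[OF \<omega>] \<omega> orbit_prod_fixed[OF \<omega>(1)]
      by (intro H_auto) simp_all
    \<comment> \<open>With s = 1 the bound ms becomes m.\<close>
    have "AutD.ord idD = 1"
      using AutD.ord_id by simp
    then show ?thesis
      using H H_order_finite[OF \<omega> idD_auto H, of 1] AutA.cyclic_group_generated
        AutA.subgroup_subgroup_generated by simp
  qed
  moreover have "H \<tau> \<omega> \<in> carrier AutA"
    if "\<omega> \<in> carrier S0" "\<omega> [^]\<^bsub>D\<^esub> m = \<one>\<^bsub>D\<^esub>" "\<tau> \<in> carrier AutD"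
      "\<forall>a\<in>carrier D. \<tau> (\<sigma> a) = \<sigma> (\<tau> a)" "\<tau> d = c m \<omega> \<otimes>\<^bsub>D\<^esub> d" for \<omega> \<tau>
    using that root_of_unity_unit by (intro H_auto) auto
  ultimately show ?thesis
    unfolding Let_def
    using autos_extending_id_iso[OF assms(5)] subgroup_norm_one_units H_order_finite H_order_infinite
    by (intro conjI ballI impI allI) (simp_all del: algebra_auto_group_simps fixed_center_ring_carrier)
qed

end
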